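(* Every isothermic cycle pattern lifts to an isothermic congruence (that is, for every isothermic cycle pattern $(u,u_F)$ there is an isothermic congruence whose projected cycle pattern is $(u,u_F)$), and every isothermic congruence projects to an isothermic cycle pattern (that is, its projected cycle pattern is an isothermic cycle pattern).
   Context: $\mathbb{Z}^2$ is the vertex set of the square lattice graph, $F(\mathbb{Z}^2)$ its set of unit square faces. Black vertices: $z_1+z_2$ even; white vertices: $z_1+z_2$ odd. A face has the form $f=(w,b,w',b')$ with $w,w'$ white and $b,b'$ black. Lorentz space $\mathbf{L}^3$ is $\mathbb{R}^3$ with $\langle x,y\rangle = x_1y_1+x_2y_2-x_3y_3$; $\mathbf{E}^2=\{x_3=0\}$, and $\pi(x_1,x_2,x_3)=(x_1,x_2,0)$. A plane is spacelike if $\langle\cdot,\cdot\rangle$ restricted to its direction space is positive definite. An oriented timelike sphere has center $m$ and signed radius $r\ne0$; its point set is $\{x:\langle x-m,x-m\rangle=r^2\}$ (outward oriented if $r>0$, inward if $r<0$). A null-sphere with center $m$ is $\{x:\langle x-m,x-m\rangle=0\}$ (signed radius $0$). An isotropic line is $L=\{q+td : t\in\mathbb{R}\}$ with $d\ne0$, $\langle d,d\rangle=0$; it lies in the unique isotropic plane $H_L=\{x:\langle x-q,d\rangle=0\}$. An orientation of $L$ is the choice of a component $\Omega$ of $H_L\setminus L$. A null-sphere is in contact with $(L,\Omega)$ iff its center lies on $L$. An oriented timelike sphere $(m,r)$ is in contact with $(L,\Omega)$ iff it contains $L$ (forcing $m\in H_L\setminus L$) and $m\notin\Omega$ if $r>0$,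 $m\in\Omega$ if $r<0$. A contact congruence is a pair of maps $c$ (from $\mathbb{Z}^2$ to oriented timelike spheres and null-spheres) and $c_F$ (from $F(\mathbb{Z}^2)$ to oriented isotropic lines) with $c(v)$ in oriented contact with $c_F(f)$ whenever $v,f$ are incident. It is a null congruence if $c(b)$ is a null-sphere for every black $b$ and $c(w)$ is an oriented timelike sphere for every white $w$. An isothermic congruence is a null congruence such that the centers of the white spheres form a spacelike conjugate net: for each black vertex $b$ the centers of the four spheres $c(w)$, $w$ adjacent to $b$, are contained in a spacelike plane. Oriented circles in $\mathbf{E}^2$ are pairs (center $a$, signed radius $r\in\mathbb{R}$), $r=0$ meaning a point. An oriented line in $\mathbf{E}^2$ is a line $\ell$ with a chosen side (open half-plane) $\omega$. An oriented circle $(a,r)$ is in contact with $(\ell,\omega)$ if the distance from $a$ to $\ell$ is $|r|$ and $a\notin\omega$ if $r>0$, $a\in\omega$ if $r<0$. A cycle pattern is a pair of maps $u$ (from $\mathbb{Z}^2$ to oriented circles) and $u_F$ (from $F(\mathbb{Z}^2)$ to oriented lines of $\mathbf{E}^2$) with $u(v)$ in contact with $u_F(f)$ whenever $v,f$ are incident. It is an incircular cycle pattern if $u(b)$ has radius $0$ for every black $b$. Projected cycle pattern of a contact congruence $(c,c_F)$: if $c(v)$ has center $m$ and signed radius $r$, then $u(v)$ is the oriented circle with center $\pi(m)$ and signed radius $r$; if $c_F(f)=(L,\Omega)$, then $u_F(f)$ is the line $\pi(L)$ with the side containing $\pi(\Omega)$. Miquel dynamics $\mathscr{M}(u)$ of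 a cycle pattern $u$: the white circles are kept, $\mathscr{M}(u)(w)=u(w)$; for each face $f=(w,b,w',b')$ the oriented line $u_F(f)$ is replaced by the other common oriented tangent $\mathscr{M}(u)_F(f)$ of the two oriented circles $u(w),u(w')$; and for each black vertex $b$ the oriented circle $u(b)$ is replaced by the oriented circle $\mathscr{M}(u)(b)$ in contact with the four lines $\mathscr{M}(u)_F(f)$, $f$ incident with $b$. An isothermic cycle pattern is an incircular cycle pattern $u$ such that $\mathscr{M}(u)$ is also an incircular cycle pattern; equivalently, at each black vertex $b$ the four lines $\mathscr{M}(u)_F(f)$, $f$ incident with $b$, pass through a common point.
   Formalization: Added. Lift: white radii nonzero; at each edge the two face lines are all common tangents (in u and M(u)); b and M(u)(b) are equal or strictly on one side of the line of the white centers in each face. Projection: the white spheres of a face differ. Touching circles: tangent counts twice. *)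

theory Defs
  imports "HOL-Analysis.Analysis"
begin

section \<open>The square lattice\<close>

type_synonym vertex = "int \<times> int"

text \<open>A unit square face is represented by its lower left corner.\<close>

type_synonym face = "int \<times> int"

definition black :: "vertex \<Rightarrow> bool" where
  "black z \<longleftrightarrow> even (fst z + snd z)"

definition white :: "vertex \<Rightarrow> bool" where
  "white z \<longleftrightarrow> odd (fst z + snd z)"

definition adjacent :: "vertex \<Rightarrow> vertex \<Rightarrow> bool" where
  "adjacent z z' \<longleftrightarrow> \<bar>fst z - fst z'\<bar> + \<bar>snd z - snd z'\<bar> = 1"

definition face_vertices :: "face \<Rightarrow> vertex set" where
  "face_vertices f = {fst f, fst f + 1} \<times> {snd f, snd f + 1}"

definition white_vertices :: "face \<Rightarrow> vertex set" where
  "white_vertices f = {v \<in> face_vertices f. white v}"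


section \<open>Lorentz space\<close>

definition lorentz :: "real^3 \<Rightarrow> real^3 \<Rightarrow> real" where
  "lorentz x y = x$1 * y$1 + x$2 * y$2 - x$3 * y$3"

definition E2 :: "(real^3) set" where
  "E2 = {x. x$3 = 0}"

definition proj :: "real^3 \<Rightarrow> real^3" where
  "proj x = vector [x$1, x$2, 0]"

definition spacelike_plane :: "(real^3) set \<Rightarrow> bool" where
  "spacelike_plane P \<longleftrightarrow>
     (\<exists>p V. subspace V \<and> dim V = 2 \<and> (\<forall>x\<in>V. x \<noteq> 0 \<longrightarrow> lorentz x x > 0) \<and>
            P = (\<lambda>x. p + x) ` V)"

text \<open>A sphere is a pair (center, signed radius): an oriented timelike sphere if the radius
  is nonzero, a null-sphere if it is zero.\<close>

type_synonym lsphere = "(real^3) \<times> real"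

definition lsphere_points :: "lsphere \<Rightarrow> (real^3) set" where
  "lsphere_points S = {x. lorentz (x - fst S) (x - fst S) = (snd S)\<^sup>2}"

text \<open>Oriented lines, both the isotropic ones and those of \<^term>\<open>E2\<close>, are pairs
  \<open>(L, \<Omega>)\<close> of the line and the chosen side, the latter being a connected component of the
  complement of the line in its plane.\<close>

type_synonym oline = "(real^3) set \<times> (real^3) set"

definition isotropic_oline :: "oline \<Rightarrow> bool" where
  "isotropic_oline T \<longleftrightarrow>
     (\<exists>q d. d \<noteq> 0 \<and> lorentz d d = 0 \<and> fst T = {q + t *\<^sub>R d |t. True} \<and>
            snd T \<in> components ({x. lorentz (x - q) d = 0} - fst T))"

definition lsphere_contact :: "lsphere \<Rightarrow> oline \<Rightarrow> bool" where
  "lsphere_contact S T \<longleftrightarrow>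
     (if snd S = 0 then fst S \<in> fst T
      else fst T \<subseteq> lsphere_points S \<and>
           (snd S > 0 \<longrightarrow> fst S \<notin> snd T) \<and> (snd S < 0 \<longrightarrow> fst S \<in> snd T))"

type_synonym congruence = "(vertex \<Rightarrow> lsphere) \<times> (face \<Rightarrow> oline)"

fun contact_congruence :: "congruence \<Rightarrow> bool" where
  "contact_congruence (c, cF) \<longleftrightarrow>
     (\<forall>f. isotropic_oline (cF f)) \<and>
     (\<forall>f. \<forall>v\<in>face_vertices f. lsphere_contact (c v) (cF f))"

fun null_congruence :: "congruence \<Rightarrow> bool" where
  "null_congruence (c, cF) \<longleftrightarrow>
     contact_congruence (c, cF) \<and>
     (\<forall>b. black b \<longrightarrow> snd (c b) = 0) \<and> (\<forall>w. white w \<longrightarrow> snd (c w) \<noteq> 0)"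

fun isothermic_congruence :: "congruence \<Rightarrow> bool" where
  "isothermic_congruence (c, cF) \<longleftrightarrow>
     null_congruence (c, cF) \<and>
     (\<forall>b. black b \<longrightarrow> (\<exists>P. spacelike_plane P \<and> (\<forall>w. adjacent b w \<longrightarrow> fst (c w) \<in> P)))"


section \<open>Cycle patterns\<close>

text \<open>An oriented circle of \<^term>\<open>E2\<close> is a pair (center, signed radius) with center in
  \<^term>\<open>E2\<close>; radius zero means a point.\<close>

type_synonym ocircle = "(real^3) \<times> real"

definition E2_oline :: "oline \<Rightarrow> bool" where
  "E2_oline T \<longleftrightarrow>
     (\<exists>a\<in>E2. \<exists>e\<in>E2. e \<noteq> 0 \<and> fst T = {a + t *\<^sub>R e |t. True} \<and>
            snd T \<in> components (E2 - fst T))"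

definition circle_contact :: "ocircle \<Rightarrow> oline \<Rightarrow> bool" where
  "circle_contact C T \<longleftrightarrow>
     infdist (fst C) (fst T) = \<bar>snd C\<bar> \<and>
     (snd C > 0 \<longrightarrow> fst C \<notin> snd T) \<and> (snd C < 0 \<longrightarrow> fst C \<in> snd T)"

type_synonym pattern = "(vertex \<Rightarrow> ocircle) \<times> (face \<Rightarrow> oline)"

fun cycle_pattern :: "pattern \<Rightarrow> bool" where
  "cycle_pattern (u, uF) \<longleftrightarrow>
     (\<forall>v. fst (u v) \<in> E2) \<and> (\<forall>f. E2_oline (uF f)) \<and>
     (\<forall>f. \<forall>v\<in>face_vertices f. circle_contact (u v) (uF f))"

fun incircular_pattern :: "pattern \<Rightarrow> bool" where
  "incircular_pattern (u, uF) \<longleftrightarrow>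
     cycle_pattern (u, uF) \<and> (\<forall>b. black b \<longrightarrow> snd (u b) = 0)"

definition projected_oline :: "oline \<Rightarrow> oline" where
  "projected_oline T =
     (proj ` fst T, THE \<omega>. \<omega> \<in> components (E2 - proj ` fst T) \<and> proj ` snd T \<subseteq> \<omega>)"

fun projected_pattern :: "congruence \<Rightarrow> pattern" where
  "projected_pattern (c, cF) =
     ((\<lambda>v. (proj (fst (c v)), snd (c v))), (\<lambda>f. projected_oline (cF f)))"

definition common_tangents :: "ocircle \<Rightarrow> ocircle \<Rightarrow> oline set" where
  "common_tangents C C' = {T. E2_oline T \<and> circle_contact C T \<and> circle_contact C' T}"

text \<open>\<open>miquel U V\<close> means that \<open>V\<close> is the image of \<open>U\<close> under Miquel dynamics. That \<open>vF f\<close> is the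
  other common tangent of the two white circles \<open>u w\<close>, \<open>u w'\<close> of \<open>f\<close> is expressed by
  \<open>{uF f, vF f}\<close> being the set of all their common tangents. So if the circles touch, the
  single common tangent counts twice, and Miquel dynamics is undefined if they coincide.\<close>

fun miquel :: "pattern \<Rightarrow> pattern \<Rightarrow> bool" where
  "miquel (u, uF) (v, vF) \<longleftrightarrow>
     cycle_pattern (v, vF) \<and>
     (\<forall>w. white w \<longrightarrow> v w = u w) \<and>
     (\<forall>f. \<forall>w\<in>white_vertices f. \<forall>w'\<in>white_vertices f. w \<noteq> w' \<longrightarrow>
        common_tangents (u w) (u w') = {uF f, vF f})"

definition isothermic_pattern :: "pattern \<Rightarrow> bool" where
  "isothermic_pattern U \<longleftrightarrow>
     incircular_pattern U \<and> (\<exists>V. miquel U V \<and> incircular_pattern V)"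


section \<open>Genericity\<close>

text \<open>For each edge, the lines of the two faces at that edge are the two common
  tangents of the circles at its ends (again with multiplicity). Without this the two lines
  could coincide although there is a second tangent.\<close>

fun edge_tangents :: "pattern \<Rightarrow> bool" where
  "edge_tangents (u, uF) \<longleftrightarrow>
     (\<forall>z z'. adjacent z z' \<longrightarrow>
        common_tangents (u z) (u z') = uF ` {f. {z, z'} \<subseteq> face_vertices f})"

text \<open>The planar counterpart of the spacelike condition: for a face with white circles \<open>u w\<close>,
  \<open>u w'\<close>, the points \<open>u b\<close> and \<open>v b\<close> lie strictly on the same side of the line through the
  centers of \<open>u w\<close> and \<open>u w'\<close>, unless they are equal. In a lift, \<open>u b\<close> and \<open>v b\<close> become mirror
  images in the plane of the centers of the adjacent white spheres; they are on opposite sides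
  if that plane is timelike. Such patterns exist: take the centers of all white circles on one
  line, and \<open>v\<close> the mirror image of \<open>u\<close> in that line.\<close>

fun same_side :: "pattern \<Rightarrow> pattern \<Rightarrow> bool" where
  "same_side (u, uF) (v, vF) \<longleftrightarrow>
     (\<forall>f. \<forall>b\<in>face_vertices f. \<forall>w\<in>white_vertices f. \<forall>w'\<in>white_vertices f.
        black b \<and> w \<noteq> w' \<longrightarrow>
        fst (u b) = fst (v b) \<or>
        closed_segment (fst (u b)) (fst (v b)) \<inter> affine hull {fst (u w), fst (u w')} = {})"

definition generic_pattern :: "pattern \<Rightarrow> bool" where
  "generic_pattern U \<longleftrightarrow>
     (\<forall>w. white w \<longrightarrow> snd (fst U w) \<noteq> 0) \<and> edge_tangents U \<and>
     (\<forall>V. miquel U V \<and> incircular_pattern V \<longrightarrow> edge_tangents V \<and> same_side U V)"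

text \<open>Without this, Miquel dynamics of the projected pattern is undefined.\<close>

definition generic_congruence :: "congruence \<Rightarrow> bool" where
  "generic_congruence C \<longleftrightarrow> (\<forall>f. inj_on (fst C) (white_vertices f))"

end

(*
  Write an oriented line of the plane as {x. n.x = h} with side {x. n.x > h}, n a unit normal. Then
  contact with the circle (a, r) is the linear equation n.a + r = h. An isotropic line over it is
  given by a sign s and an offset k, and contact with a sphere of center m adds the single equation
  m3 = s (n1 m2 - n2 m1) + k. So a lift of a cycle pattern amounts to heights whose differences
  along each face are s times differences of tangential coordinates n1 a2 - n2 a1. The two common
  tangents of two circles are mirror images in the line of centers, so these differences change
  sign from a face to its neighbour; with s alternating on the faces, the height differences are
  well defined and sum to zero around each face, hence integrate to heights.

  For the same reason Miquel dynamics keeps the heights of the white centers when all signs are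
  reversed. The lifts of u(b) and M(u)(b) are then null-sphere centers in contact with the same four
  white spheres, so the white centers lie in the Lorentz bisector plane of these two points, and
  this plane is spacelike iff the difference of the points is timelike. Conversely, reflecting the
  lift of u(b) in the spacelike plane of the adjacent white centers yields M(u)(b).
*)
theory Submission
  imports Defs
begin

declare split_paired_All [simp del] split_paired_Ex [simp del]

section \<open>Components of the complement of a line\<close>

lemmas vec3_simps =
  vec_eq_iff forall_3 vector_3 inner_vec_def sum_3

text \<open>Both halves are convex, hence connected. They are maximal because the linear functional
  maps a connected set to an interval, so a connected set avoiding the hyperplane stays on one side
  of it.\<close>

lemma components_convex_minus_hyperplane:
  fixes A :: "'a::euclidean_space set"
  assumes "convex A" "A \<inter> {x. a \<bullet> x > c} \<noteq> {}" "A \<inter> {x. a \<bullet> x < c} \<noteq> {}"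
  shows "components (A - {x. a \<bullet> x = c}) = {A \<inter> {x. a \<bullet> x > c}, A \<inter> {x. a \<bullet> x < c}}"
proof -
  let ?S = "A - {x. a \<bullet> x = c}" and ?P = "A \<inter> {x. a \<bullet> x > c}" and ?N = "A \<inter> {x. a \<bullet> x < c}"
  have conn: "connected ?P" "connected ?N"
    using assms(1) by (auto intro!: convex_connected convex_Int convex_halfspace_gt convex_halfspace_lt)
  have one_sided: "D \<subseteq> ?P \<or> D \<subseteq> ?N" if D: "D \<subseteq> ?S" "connected D" for D
  proof (rule ccontr)
    assume "\<not> ?thesis"
    then obtain x y where xy: "x \<in> D" "y \<in> D" "a \<bullet> x \<le> c" "a \<bullet> y \<ge> c"
      using D(1) by (fastforce simp: not_less)
    have "connected ((\<bullet>) a ` D)"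
      by (intro connected_continuous_image continuous_intros D(2))
    then have "c \<in> (\<bullet>) a ` D"
      using xy connectedD_interval[of "(\<bullet>) a ` D" "a \<bullet> x" "a \<bullet> y" c] by auto
    then show False using D(1) by auto
  qed
  have "?P \<in> components ?S"
    unfolding in_components_maximal
  proof (intro conjI allI impI)
    fix D assume D: "D \<noteq> {} \<and> ?P \<subseteq> D \<and> D \<subseteq> ?S \<and> connected D"
    then have "D \<subseteq> ?P \<or> D \<subseteq> ?N" by (intro one_sided) auto
    moreover have "\<not> ?P \<subseteq> ?N" using assms(2) by auto
    ultimately show "D = ?P" using D by blast
  qed (use assms(2) conn in auto)
  moreover have "?N \<in> components ?S"
    unfolding in_components_maximal
  proof (intro conjI allI impI)
    fix D assume D: "D \<noteq> {} \<and> ?N \<subseteq> D \<and> D \<subseteq> ?S \<and> connected D"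
    then have "D \<subseteq> ?P \<or> D \<subseteq> ?N" by (intro one_sided) auto
    moreover have "\<not> ?N \<subseteq> ?P" using assms(3) by auto
    ultimately show "D = ?N" using D by blast
  qed (use assms(3) conn in auto)
  moreover have "C = ?P \<or> C = ?N" if C: "C \<in> components ?S" for C
  proof -
    have max: "D = C" if "D \<noteq> {}" "C \<subseteq> D" "D \<subseteq> ?S" "connected D" for D
      using C that unfolding in_components_maximal by blast
    have "C \<subseteq> ?P \<or> C \<subseteq> ?N"
      using one_sided in_components_subset[OF C] in_components_connected[OF C] by blast
    then show ?thesis using max[of ?P] max[of ?N] conn assms(2,3) by auto
  qed
  ultimately show ?thesis by blast
qed
section \<open>Normal forms of oriented lines\<close>

text \<open>Hesse normal form; \<open>n1\<close>, \<open>n2\<close> are meant as a unit vector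
  pointing into the chosen side. Negating all three parameters reverses the orientation.\<close>

definition normal_oline :: "real \<Rightarrow> real \<Rightarrow> real \<Rightarrow> oline" where
  "normal_oline n1 n2 h = ({x\<in>E2. n1 * x$1 + n2 * x$2 = h}, {x\<in>E2. n1 * x$1 + n2 * x$2 > h})"

lemma E2_inner: "E2 = {x. vector [0, 0, 1] \<bullet> x = (0::real)}"
  by (auto simp: E2_def vec3_simps)

lemma components_E2_minus_line:
  assumes "n1\<^sup>2 + n2\<^sup>2 = 1"
  shows "components (E2 - {x\<in>E2. n1 * x$1 + n2 * x$2 = h}) = {snd (normal_oline n1 n2 h), snd (normal_oline (-n1) (-n2) (-h))}"
proof -
  let ?n = "vector [n1, n2, 0] :: real^3"
  have n: "?n \<bullet> x = n1 * x$1 + n2 * x$2" for x by (simp add: vec3_simps)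
  have *: "n1 * (t * n1) + n2 * (t * n2) = t" for t
    using assms by (simp add: power2_eq_square) algebra
  \<comment> \<open>Points on the normal through the origin at distance 1 from the line, one on each
    side.\<close>
  have "vector [(h+1) * n1, (h+1) * n2, 0] \<in> E2 \<inter> {x. ?n \<bullet> x > h}"
    "vector [(h-1) * n1, (h-1) * n2, 0] \<in> E2 \<inter> {x. ?n \<bullet> x < h}"
    unfolding n by (auto simp: E2_def vector_3 *)
  then have "components (E2 - {x. ?n \<bullet> x = h}) = {E2 \<inter> {x. ?n \<bullet> x > h}, E2 \<inter> {x. ?n \<bullet> x < h}}"
    by (intro components_convex_minus_hyperplane) (auto simp: E2_inner convex_hyperplane)
  moreover have "E2 - {x. ?n \<bullet> x = h} = E2 - {x\<in>E2. n1 * x$1 + n2 * x$2 = h}" by (auto simp: n)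
  moreover have "E2 \<inter> {x. ?n \<bullet> x > h} = snd (normal_oline n1 n2 h)" by (auto simp: n normal_oline_def)
  moreover have "E2 \<inter> {x. ?n \<bullet> x < h} = snd (normal_oline (-n1) (-n2) (-h))" by (auto simp: n normal_oline_def)
  ultimately show ?thesis by simp
qed

text \<open>A vector orthogonal to the unit normal is a multiple of the rotated normal
  \<open>(- n2, n1)\<close>; the factor is its tangential coordinate.\<close>

lemma unit_rotate:
  fixes n1 n2 :: real
  assumes "n1\<^sup>2 + n2\<^sup>2 = 1" "n1 * x + n2 * y = 0"
  shows "x = - n2 * (n1 * y - n2 * x)" "y = n1 * (n1 * y - n2 * x)"
  using assms by algebra+
text \<open>Rotating the direction by a right angle and normalizing gives a unit normal; the chosen
  side decides between it and its negative.\<close>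

lemma E2_oline_iff:
  "E2_oline T \<longleftrightarrow> (\<exists>n1 n2 h. n1\<^sup>2 + n2\<^sup>2 = 1 \<and> T = normal_oline n1 n2 h)" (is "?l \<longleftrightarrow> ?r")
proof
  assume ?l
  then obtain a e where *: "a \<in> E2" "e \<in> E2" "e \<noteq> 0" "fst T = {a + t *\<^sub>R e |t. True}"
     "snd T \<in> components (E2 - fst T)" unfolding E2_oline_def by blast
  define l where "l = sqrt ((e$1)\<^sup>2 + (e$2)\<^sup>2)"
  have ne: "(e$1)\<^sup>2 + (e$2)\<^sup>2 \<noteq> 0" using *(2,3) by (auto simp: E2_def vec3_simps sum_power2_eq_zero_iff)
  then have l: "l > 0" "l\<^sup>2 = (e$1)\<^sup>2 + (e$2)\<^sup>2"
    unfolding l_def by (auto simp: sum_power2_gt_zero_iff)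
  define n1 n2 where "n1 = - e$2 / l" and "n2 = e$1 / l"
  define h where "h = n1 * a$1 + n2 * a$2"
  have n: "n1\<^sup>2 + n2\<^sup>2 = 1" using l ne by (simp only: n1_def n2_def power_divide power2_minus flip: add_divide_distrib) simp
  have e: "e$1 = l * n2" "e$2 = - l * n1" using l by (auto simp: n1_def n2_def)
  have line: "fst T = {x\<in>E2. n1 * x$1 + n2 * x$2 = h}"
  proof (intro equalityI subsetI)
    fix x assume "x \<in> fst T"
    then obtain t where "x = a + t *\<^sub>R e" using * by blast
    then show "x \<in> {x\<in>E2. n1 * x$1 + n2 * x$2 = h}"
      using *(1,2) by (simp add: E2_def h_def e algebra_simps)
  next
    fix x assume x: "x \<in> {x\<in>E2. n1 * x$1 + n2 * x$2 = h}"
    \<comment> \<open>In the plane, \<open>e\<close> is \<open>- l\<close> times the rotated normal,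
      so tangential coordinate \<open>c\<close> belongs to the parameter
      \<open>- c / l\<close>.\<close>
    define c where "c = n1 * (x$2 - a$2) - n2 * (x$1 - a$1)"
    let ?t = "- c / l"
    have "n1 * (x$1 - a$1) + n2 * (x$2 - a$2) = 0" using x by (simp add: h_def algebra_simps)
    from unit_rotate[OF n this, folded c_def] have "x$1 - a$1 = ?t * e$1" "x$2 - a$2 = ?t * e$2"
      using l(1) unfolding e by (simp_all add: mult.commute)
    moreover have "x$3 - a$3 = ?t * e$3" using x *(1,2) by (simp add: E2_def)
    ultimately have "x - a = ?t *\<^sub>R e"
      unfolding vec_eq_iff forall_3 vector_minus_component vector_scaleR_component real_scaleR_def by blast
    then have "x = a + ?t *\<^sub>R e" by (metis add.commute diff_add_cancel)
    then show "x \<in> fst T" using * by blast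
  qed
  have "T = normal_oline n1 n2 h \<or> T = normal_oline (-n1) (-n2) (-h)"
  proof -
    have "snd T = snd (normal_oline n1 n2 h) \<or> snd T = snd (normal_oline (-n1) (-n2) (-h))"
      using *(5) unfolding line components_E2_minus_line[OF n] by simp
    moreover have "fst T = fst (normal_oline n1 n2 h)" "fst T = fst (normal_oline (-n1) (-n2) (-h))"
      unfolding line by (auto simp: normal_oline_def)
    ultimately show ?thesis by (metis prod_eqI)
  qed
  then show ?r using n by (metis power2_minus[of n1] power2_minus[of n2])
next
  assume ?r
  then obtain n1 n2 h where n: "n1\<^sup>2 + n2\<^sup>2 = 1" and T: "T = normal_oline n1 n2 h" by blast
  \<comment> \<open>The foot of the perpendicular from the origin, and the rotated normal as
    direction.\<close>
  let ?a = "vector [h * n1, h * n2, 0] :: real^3" and ?e = "vector [- n2, n1, 0] :: real^3"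
  have hn: "n1 * (h * n1) + n2 * (h * n2) = h" using n by algebra
  have line: "fst T = {?a + t *\<^sub>R ?e |t. True}"
  proof (intro equalityI subsetI)
    fix x assume "x \<in> {?a + t *\<^sub>R ?e |t. True}"
    then show "x \<in> fst T" using hn by (auto simp: T normal_oline_def E2_def vector_3 algebra_simps)
  next
    fix x assume x: "x \<in> fst T"
    define c where "c = n1 * x$2 - n2 * x$1"
    have perp: "n1 * (x$1 - h * n1) + n2 * (x$2 - h * n2) = 0"
      using x hn by (auto simp: T normal_oline_def algebra_simps)
    have "n1 * (x$2 - h * n2) - n2 * (x$1 - h * n1) = c" by (simp add: c_def algebra_simps)
    from unit_rotate[OF n perp, unfolded this] have x12: "x$1 = h * n1 - c * n2" "x$2 = h * n2 + c * n1"
      by (simp_all add: algebra_simps)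
    have "x$3 = 0" using x by (simp add: T normal_oline_def E2_def c_def)
    with x12 have "x = ?a + c *\<^sub>R ?e" by (simp add: vec3_simps)
    then show "x \<in> {?a + t *\<^sub>R ?e |t. True}" by blast
  qed
  have "?a \<in> E2" "?e \<in> E2" "?e \<noteq> 0" using n by (auto simp: E2_def vec3_simps)
  moreover have "snd T \<in> components (E2 - fst T)"
    using components_E2_minus_line[OF n] by (simp add: T normal_oline_def)
  ultimately show ?l unfolding E2_oline_def using line by blast
qed

text \<open>The second functional is constant along the line, which makes the normals parallel; a
  point of the common side excludes opposite normals.\<close>

lemma normal_oline_eqD:
  assumes "n1\<^sup>2 + n2\<^sup>2 = 1" "m1\<^sup>2 + m2\<^sup>2 = 1" "normal_oline n1 n2 h = normal_oline m1 m2 g"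
  shows "n1 = m1" "n2 = m2" "h = g"
proof -
  \<comment> \<open>The point with normal coordinate \<open>s\<close> and tangential coordinate
    \<open>t\<close>.\<close>
  let ?p = "\<lambda>s t. vector [s * n1 - t * n2, s * n2 + t * n1, 0] :: real^3"
  have n: "n1 * (s * n1 - t * n2) + n2 * (s * n2 + t * n1) = s" for s t
    using assms(1) by algebra
  have p: "?p s t \<in> E2" for s t by (simp add: E2_def vector_3)
  have "?p h t \<in> fst (normal_oline n1 n2 h)" for t using p[of h t] n by (simp add: normal_oline_def vector_3)
  then have eq: "m1 * (h * n1 - t * n2) + m2 * (h * n2 + t * n1) = g" for t
    unfolding assms(3) by (simp add: normal_oline_def vector_3)
  have "?p (h + 1) 0 \<in> snd (normal_oline n1 n2 h)" using p[of "h+1" 0] n[of "h+1" 0] by (simp add: normal_oline_def vector_3)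
  then have gt: "m1 * ((h + 1) * n1) + m2 * ((h + 1) * n2) > g"
    unfolding assms(3) by (simp add: normal_oline_def vector_3)
  have perp: "m2 * n1 - m1 * n2 = 0" using eq[of 0] eq[of 1] by (simp add: algebra_simps)
  have pos: "m1 * n1 + m2 * n2 > 0" using eq[of 0] gt by (simp add: algebra_simps)
  have "(m1 * n1 + m2 * n2)\<^sup>2 = 1" using assms(1,2) perp by algebra
  then have 1: "m1 * n1 + m2 * n2 = 1" using pos by (auto simp: power2_eq_1_iff)
  show "n1 = m1" "n2 = m2" using assms(1,2) perp 1 by algebra+
  then show "h = g" using eq[of 0] 1 by (simp add: algebra_simps) (metis 1 mult.commute mult.left_commute distrib_left mult_1_right)
qed
text \<open>The foot of the perpendicular attains the value; Cauchy-Schwarz with the unit normal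
  bounds every other distance from below.\<close>

lemma infdist_line:
  assumes n: "n1\<^sup>2 + n2\<^sup>2 = 1" and a: "a \<in> E2"
  shows "infdist a (fst (normal_oline n1 n2 h)) = \<bar>n1 * a$1 + n2 * a$2 - h\<bar>"
proof -
  let ?n = "vector [n1, n2, 0] :: real^3"
  have n1: "norm ?n = 1" using n by (simp add: norm_eq_1 vec3_simps power2_eq_square)
  have ni: "?n \<bullet> x = n1 * x$1 + n2 * x$2" for x by (simp add: vec3_simps)
  define l where "l = n1 * a$1 + n2 * a$2 - h"
  let ?q = "a - l *\<^sub>R ?n"
  have "n1 * (l * n1) + n2 * (l * n2) = l" using n by algebra
  then have q: "?q \<in> fst (normal_oline n1 n2 h)" using a
    by (simp add: normal_oline_def E2_def vector_3 algebra_simps l_def)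
  have "infdist a (fst (normal_oline n1 n2 h)) \<le> \<bar>l\<bar>"
    using infdist_le[OF q, of a] by (simp add: dist_norm n1)
  moreover have "\<bar>l\<bar> \<le> infdist a (fst (normal_oline n1 n2 h))"
    unfolding infdist_notempty[OF ex_in_conv[THEN iffD1, OF exI, OF q]]
  proof (rule cINF_greatest)
    show "fst (normal_oline n1 n2 h) \<noteq> {}" using q by blast
    fix x assume "x \<in> fst (normal_oline n1 n2 h)"
    then have "?n \<bullet> (a - x) = l" by (simp add: inner_diff_right ni l_def normal_oline_def)
    then show "\<bar>l\<bar> \<le> dist a x" using Cauchy_Schwarz_ineq2[of ?n "a - x"] by (simp add: n1 dist_norm)
  qed
  ultimately show ?thesis by (simp add: l_def)
qed

text \<open>The distance fixes \<open>n1 * a$1 + n2 * a$2 - h\<close> up to sign, and the side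
  condition selects the value \<open>- r\<close>.\<close>

lemma circle_contact_normal_oline:
  assumes "n1\<^sup>2 + n2\<^sup>2 = 1" "a \<in> E2"
  shows "circle_contact (a, r) (normal_oline n1 n2 h) \<longleftrightarrow> n1 * a$1 + n2 * a$2 + r = h"
  using assms(2) unfolding circle_contact_def fst_conv infdist_line[OF assms]
  by (auto simp: normal_oline_def abs_if split: if_splits)

text \<open>\<open>s\<close> is 1 or -1; reversing it turns the slope of the line upside down and keeps the projection.\<close>

definition lifted_oline :: "real \<Rightarrow> real \<Rightarrow> real \<Rightarrow> real \<Rightarrow> real \<Rightarrow> oline" where
  "lifted_oline n1 n2 s h k = ({x. x$3 = s * (n1 * x$2 - n2 * x$1) + k \<and> n1 * x$1 + n2 * x$2 = h},
     {x. x$3 = s * (n1 * x$2 - n2 * x$1) + k \<and> n1 * x$1 + n2 * x$2 > h})"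

text \<open>Reversing the normal changes the sign of the tangential coordinate, so the same plane is
  described with \<open>s\<close> negated and \<open>k\<close> kept.\<close>

lemma components_isotropic_plane_minus_line:
  assumes n: "n1\<^sup>2 + n2\<^sup>2 = 1"
  shows "components ({x. x$3 = s * (n1 * x$2 - n2 * x$1) + k} - fst (lifted_oline n1 n2 s h k))
    = {snd (lifted_oline n1 n2 s h k), snd (lifted_oline (-n1) (-n2) (-s) (-h) k)}"
proof -
  let ?n = "vector [n1, n2, 0] :: real^3"
  let ?A = "{x::real^3. x$3 = s * (n1 * x$2 - n2 * x$1) + k}"
  have A: "?A = {x. vector [s * n2, - s * n1, 1] \<bullet> x = k}" by (auto simp: vec3_simps algebra_simps)
  have ni: "?n \<bullet> x = n1 * x$1 + n2 * x$2" for x by (simp add: vec3_simps)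
  have *: "n1 * (t * n1) + n2 * (t * n2) = t" for t
    using n by (simp add: power2_eq_square) algebra
  have "vector [(h+1) * n1, (h+1) * n2, k] \<in> ?A \<inter> {x. ?n \<bullet> x > h}"
    "vector [(h-1) * n1, (h-1) * n2, k] \<in> ?A \<inter> {x. ?n \<bullet> x < h}"
    unfolding ni by (auto simp: vector_3 *)
  then have "components (?A - {x. ?n \<bullet> x = h}) = {?A \<inter> {x. ?n \<bullet> x > h}, ?A \<inter> {x. ?n \<bullet> x < h}}"
    by (intro components_convex_minus_hyperplane) (auto simp: A convex_hyperplane)
  moreover have "?A - {x. ?n \<bullet> x = h} = ?A - fst (lifted_oline n1 n2 s h k)" by (auto simp: ni lifted_oline_def)
  moreover have "?A \<inter> {x. ?n \<bullet> x > h} = snd (lifted_oline n1 n2 s h k)" by (auto simp: ni lifted_oline_def)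
  moreover have "?A \<inter> {x. ?n \<bullet> x < h} = snd (lifted_oline (-n1) (-n2) (-s) (-h) k)"
    by (auto simp: ni lifted_oline_def algebra_simps)
  ultimately show ?thesis by simp
qed
text \<open>The horizontal part of an isotropic direction is as long as its vertical part. Hence the
  line rises with slope 1 or -1 over its projection, and \<open>s\<close> is the sign of the slope
  along the rotated normal.\<close>

lemma isotropic_oline_iff:
  "isotropic_oline T \<longleftrightarrow> (\<exists>n1 n2 s h k. n1\<^sup>2 + n2\<^sup>2 = 1 \<and> s\<^sup>2 = 1 \<and> T = lifted_oline n1 n2 s h k)" (is "?l \<longleftrightarrow> ?r")
proof
  assume ?l
  then obtain q d where *: "d \<noteq> 0" "lorentz d d = 0" "fst T = {q + t *\<^sub>R d |t. True}"
     "snd T \<in> components ({x. lorentz (x - q) d = 0} - fst T)" unfolding isotropic_oline_def by blast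
  have d2: "(d$1)\<^sup>2 + (d$2)\<^sup>2 = (d$3)\<^sup>2" using *(2) by (simp add: lorentz_def power2_eq_square)
  have d3: "d$3 \<noteq> 0" using *(1) d2 by (auto simp: vec3_simps sum_power2_eq_zero_iff)
  \<comment> \<open>The normal is chosen so that \<open>d\<close> is \<open>d$3\<close> times
    \<open>(- n2, n1, 1)\<close>, which gives \<open>s = 1\<close>. The other choice of side yields
    the form with \<open>s = - 1\<close>.\<close>
  define n1 n2 where "n1 = d$2 / d$3" and "n2 = - d$1 / d$3"
  define h where "h = n1 * q$1 + n2 * q$2"
  define k where "k = q$3 - (n1 * q$2 - n2 * q$1)"
  have n: "n1\<^sup>2 + n2\<^sup>2 = 1" using d2 d3 by (simp only: n1_def n2_def power_divide power2_minus flip: add_divide_distrib) (simp add: add.commute)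
  have e: "d$1 = - d$3 * n2" "d$2 = d$3 * n1" using d3 by (auto simp: n1_def n2_def)
  have nn: "n1 * (d$3 * n1) - n2 * (- (d$3 * n2)) = d$3" using n by algebra
  have pl: "{x. lorentz (x - q) d = 0} = {x. x$3 = 1 * (n1 * x$2 - n2 * x$1) + k}"
  proof -
    have "lorentz (x - q) d = d$3 * ((n1 * x$2 - n2 * x$1) + k - x$3)" for x
      unfolding lorentz_def k_def by (simp add: e algebra_simps)
    then show ?thesis using d3 by auto
  qed
  have line: "fst T = fst (lifted_oline n1 n2 1 h k)"
  proof (intro equalityI subsetI)
    fix x assume "x \<in> fst T"
    then obtain t where x: "x = q + t *\<^sub>R d" using * by blast
    have "t * d$3 = t * (n1 * (d$3 * n1) - n2 * (- (d$3 * n2)))" using nn by simp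
    then show "x \<in> fst (lifted_oline n1 n2 1 h k)"
      by (simp add: x lifted_oline_def k_def h_def e algebra_simps)
  next
    fix x assume x: "x \<in> fst (lifted_oline n1 n2 1 h k)"
    define c where "c = n1 * (x$2 - q$2) - n2 * (x$1 - q$1)"
    let ?t = "c / d$3"
    have x3: "x$3 - q$3 = c" and "n1 * (x$1 - q$1) + n2 * (x$2 - q$2) = 0"
      using x by (auto simp: lifted_oline_def k_def h_def c_def algebra_simps)
    from unit_rotate[OF n this(2), folded c_def] have "x$1 - q$1 = ?t * d$1" "x$2 - q$2 = ?t * d$2"
      using d3 unfolding e by (simp_all add: mult.commute)
    moreover have "x$3 - q$3 = ?t * d$3" using d3 x3 by simp
    ultimately have "x - q = ?t *\<^sub>R d"
      unfolding vec_eq_iff forall_3 vector_minus_component vector_scaleR_component real_scaleR_def by blast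
    then have "x = q + ?t *\<^sub>R d" by (metis add.commute diff_add_cancel)
    then show "x \<in> fst T" using * by blast
  qed
  have "T = lifted_oline n1 n2 1 h k \<or> T = lifted_oline (-n1) (-n2) (-1) (-h) k"
  proof -
    have "snd T = snd (lifted_oline n1 n2 1 h k) \<or> snd T = snd (lifted_oline (-n1) (-n2) (-1) (-h) k)"
      using *(4) unfolding line pl components_isotropic_plane_minus_line[OF n] by simp
    moreover have "fst (lifted_oline n1 n2 1 h k) = fst (lifted_oline (-n1) (-n2) (-1) (-h) k)"
      by (auto simp: lifted_oline_def)
    ultimately show ?thesis using line by (metis prod_eqI)
  qed
  moreover have "(-n1)\<^sup>2 + (-n2)\<^sup>2 = 1" "(1::real)\<^sup>2 = 1" "(-1::real)\<^sup>2 = 1" using n by simp_all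
  ultimately show ?r using n by blast
next
  assume ?r
  then obtain n1 n2 s h k where n: "n1\<^sup>2 + n2\<^sup>2 = 1" and s: "s\<^sup>2 = 1" and T: "T = lifted_oline n1 n2 s h k" by blast
  let ?q = "vector [h * n1, h * n2, k] :: real^3" and ?d = "vector [- n2, n1, s] :: real^3"
  have ss: "s * (s * x) = x" for x using s by (simp add: power2_eq_square flip: mult.assoc)
  have hn: "n1 * (h * n1) + n2 * (h * n2) = h" using n by algebra
  have nn: "n1 * n1 + n2 * n2 = 1" using n by (simp add: power2_eq_square)
  have line: "fst T = {?q + t *\<^sub>R ?d |t. True}"
  proof (intro equalityI subsetI)
    fix x assume "x \<in> {?q + t *\<^sub>R ?d |t. True}"
    then obtain t where x: "x = ?q + t *\<^sub>R ?d" by blast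
    have "t * s = s * (n1 * (h * n2 + t * n1) - n2 * (h * n1 - t * n2))" using nn by algebra
    then show "x \<in> fst T" using hn by (auto simp: x T lifted_oline_def vector_3 algebra_simps)
  next
    fix x assume x: "x \<in> fst T"
    define c where "c = n1 * x$2 - n2 * x$1"
    have perp: "n1 * (x$1 - h * n1) + n2 * (x$2 - h * n2) = 0"
      using x hn by (auto simp: T lifted_oline_def algebra_simps)
    have "n1 * (x$2 - h * n2) - n2 * (x$1 - h * n1) = c" by (simp add: c_def algebra_simps)
    from unit_rotate[OF n perp, unfolded this] have x12: "x$1 = h * n1 - c * n2" "x$2 = h * n2 + c * n1"
      by (simp_all add: algebra_simps)
    have "x$3 = s * c + k" using x by (simp add: T lifted_oline_def c_def)
    with x12 have "x = ?q + c *\<^sub>R ?d" by (simp add: vec3_simps)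
    then show "x \<in> {?q + t *\<^sub>R ?d |t. True}" by blast
  qed
  have "?d \<noteq> 0" "lorentz ?d ?d = 0" using n s by (auto simp: vec3_simps lorentz_def power2_eq_square)
  moreover have "{x. lorentz (x - ?q) ?d = 0} = {x. x$3 = s * (n1 * x$2 - n2 * x$1) + k}"
  proof -
    have "s * lorentz (x - ?q) ?d = s * (n1 * x$2 - n2 * x$1) + k - x$3" for x
      using s unfolding lorentz_def by (simp add: vector_3) algebra
    then have "lorentz (x - ?q) ?d = 0 \<longleftrightarrow> s * (n1 * x$2 - n2 * x$1) + k - x$3 = 0" for x
      using s by (metis mult_eq_0_iff zero_power2 zero_neq_one)
    then have "lorentz (x - ?q) ?d = 0 \<longleftrightarrow> x$3 = s * (n1 * x$2 - n2 * x$1) + k" for x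
      by (metis eq_iff_diff_eq_0)
    then show ?thesis by (simp only:)
  qed
  ultimately show ?l
    unfolding isotropic_oline_def using line components_isotropic_plane_minus_line[OF n, of s k h]
    by (intro exI[of _ ?q] exI[of _ ?d]) (simp only: T, simp)
qed
text \<open>Because the line is isotropic, the Lorentz square of its points relative to the center
  is affine in the parameter. It is constant iff the center lies in the isotropic plane
  (\<open>B = 0\<close>), and then it equals \<open>A\<^sup>2\<close>; the side turns
  \<open>A\<^sup>2 = r\<^sup>2\<close> into \<open>A = - r\<close>.\<close>

lemma lsphere_contact_lifted_oline:
  assumes n: "n1\<^sup>2 + n2\<^sup>2 = 1" and s: "s\<^sup>2 = 1"
  shows "lsphere_contact (m, r) (lifted_oline n1 n2 s h k) \<longleftrightarrow>
    n1 * m$1 + n2 * m$2 + r = h \<and> m$3 = s * (n1 * m$2 - n2 * m$1) + k"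
proof (cases "r = 0")
  case True then show ?thesis by (auto simp: lsphere_contact_def lifted_oline_def)
next
  case r: False
  define A where "A = n1 * m$1 + n2 * m$2 - h"
  define B where "B = s * (n1 * m$2 - n2 * m$1) + k - m$3"
  have sub: "fst (lifted_oline n1 n2 s h k) \<subseteq> lsphere_points (m, r) \<longleftrightarrow> A\<^sup>2 = r\<^sup>2 \<and> B = 0"
  proof -
    define p where "p t = (vector [h * n1 - t * n2, h * n2 + t * n1, s * t + k] :: real^3)" for t
    have p: "p t \<in> fst (lifted_oline n1 n2 s h k)" for t
    proof -
      have "n1 * (h * n2 + t * n1) - n2 * (h * n1 - t * n2) = t"
        "n1 * (h * n1 - t * n2) + n2 * (h * n2 + t * n1) = h" using n by algebra+
      then show ?thesis by (simp add: p_def lifted_oline_def vector_3)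
    qed
    have pl: "\<exists>t. x = p t" if "x \<in> fst (lifted_oline n1 n2 s h k)" for x
    proof -
      have "x$1 = h * n1 - (n1 * x$2 - n2 * x$1) * n2" "x$2 = h * n2 + (n1 * x$2 - n2 * x$1) * n1"
        using that n unfolding lifted_oline_def by (simp_all, algebra+)
      then have "x = p (n1 * x$2 - n2 * x$1)" using that by (simp add: p_def lifted_oline_def vec3_simps)
      then show ?thesis by blast
    qed
    have q: "lorentz (p t - m) (p t - m) = A\<^sup>2 - B\<^sup>2 + 2 * B * (s * (n1 * m$2 - n2 * m$1) - s * t)" for t
      using n s unfolding lorentz_def p_def A_def B_def by (simp add: vector_3) algebra
    have eq: "fst (lifted_oline n1 n2 s h k) \<subseteq> lsphere_points (m, r) \<longleftrightarrow>
       (\<forall>t. A\<^sup>2 - B\<^sup>2 + 2 * B * (s * (n1 * m$2 - n2 * m$1) - s * t) = r\<^sup>2)" (is "_ \<longleftrightarrow> ?R")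
      using p pl by (fastforce simp: lsphere_points_def simp flip: q)
    show ?thesis
    proof
      assume "fst (lifted_oline n1 n2 s h k) \<subseteq> lsphere_points (m, r)"
      then have R: ?R using eq by blast
      have "2 * s * B = 0" using R[THEN spec, of 0] R[THEN spec, of 1]
        by (simp add: algebra_simps power2_eq_square)
      then have "B = 0" using s by auto
      then show "A\<^sup>2 = r\<^sup>2 \<and> B = 0" using R by simp
    qed (use eq in simp)
  qed
  have side: "B = 0 \<Longrightarrow> m \<in> snd (lifted_oline n1 n2 s h k) \<longleftrightarrow> A > 0"
    by (auto simp: lifted_oline_def A_def B_def)
  have "lsphere_contact (m, r) (lifted_oline n1 n2 s h k) \<longleftrightarrow> A\<^sup>2 = r\<^sup>2 \<and> B = 0 \<and> (r > 0 \<longrightarrow> \<not> A > 0) \<and> (r < 0 \<longrightarrow> A > 0)"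
    using r sub side by (auto simp: lsphere_contact_def)
  also have "\<dots> \<longleftrightarrow> A + r = 0 \<and> B = 0" using r by (auto simp: power2_eq_iff)
  finally show ?thesis by (auto simp: A_def B_def)
qed

text \<open>The isotropic plane is a graph over \<open>E2\<close>, so its sides project onto
  half-planes. The description by \<open>THE\<close> is unique since the two half-planes are
  disjoint and the projected side is nonempty.\<close>

lemma projected_lifted_oline:
  assumes n: "n1\<^sup>2 + n2\<^sup>2 = 1"
  shows "projected_oline (lifted_oline n1 n2 s h k) = normal_oline n1 n2 h"
proof -
  have im: "proj ` {x. x$3 = s * (n1 * x$2 - n2 * x$1) + k \<and> P (n1 * x$1 + n2 * x$2)}
     = {x\<in>E2. P (n1 * x$1 + n2 * x$2)}" (is "?L = ?R") for P
  proof (intro equalityI subsetI)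
    fix x assume "x \<in> ?L" then show "x \<in> ?R" by (auto simp: proj_def E2_def vector_3)
  next
    fix x assume x: "x \<in> ?R"
    then have "x = proj (vector [x$1, x$2, s * (n1 * x$2 - n2 * x$1) + k])"
      by (simp add: proj_def E2_def vec3_simps)
    then show "x \<in> ?L" by (rule image_eqI) (use x in \<open>simp add: vector_3\<close>)
  qed
  have f: "proj ` fst (lifted_oline n1 n2 s h k) = fst (normal_oline n1 n2 h)" using im[of "\<lambda>y. y = h"] by (simp add: lifted_oline_def normal_oline_def)
  have g: "proj ` snd (lifted_oline n1 n2 s h k) = snd (normal_oline n1 n2 h)" using im[of "\<lambda>y. y > h"] by (simp add: lifted_oline_def normal_oline_def)
  have comp: "components (E2 - fst (normal_oline n1 n2 h)) = {snd (normal_oline n1 n2 h), snd (normal_oline (-n1) (-n2) (-h))}"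
    using components_E2_minus_line[OF n, of h] by (simp add: normal_oline_def)
  have "vector [(h+1) * n1, (h+1) * n2, 0] \<in> snd (normal_oline n1 n2 h)"
  proof -
    have "n1 * ((h+1) * n1) + n2 * ((h+1) * n2) = h + 1" using n by algebra
    then show ?thesis by (simp add: normal_oline_def E2_def vector_3)
  qed
  moreover have "snd (normal_oline n1 n2 h) \<inter> snd (normal_oline (-n1) (-n2) (-h)) = {}" by (auto simp: normal_oline_def)
  ultimately have "\<not> snd (normal_oline n1 n2 h) \<subseteq> snd (normal_oline (-n1) (-n2) (-h))" by blast
  then have "(THE \<omega>. \<omega> \<in> components (E2 - fst (normal_oline n1 n2 h)) \<and> snd (normal_oline n1 n2 h) \<subseteq> \<omega>) = snd (normal_oline n1 n2 h)"
    unfolding comp by (intro the_equality) auto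
  then show ?thesis by (simp add: projected_oline_def f g)
qed
section \<open>Spacelike planes as graphs\<close>

text \<open>A gradient shorter than 1 means that heights grow more slowly than horizontal distances;
  Lagrange's identity writes the Lorentz square as a sum of a positive term and a square.\<close>

lemma spacelike_plane_graph:
  assumes "p\<^sup>2 + q\<^sup>2 < 1"
  shows "spacelike_plane {x. x$3 = p * x$1 + q * x$2 + c}"
proof -
  let ?a = "vector [p, q, -1] :: real^3"
  let ?V = "{x. ?a \<bullet> x = 0}"
  have a: "?a \<bullet> x = p * x$1 + q * x$2 - x$3" for x by (simp add: vec3_simps)
  have "?a \<noteq> 0" by (simp add: vec3_simps)
  then have "dim ?V = 2" by (simp add: dim_hyperplane)
  moreover have "lorentz x x > 0" if "x \<in> ?V" "x \<noteq> 0" for x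
  proof -
    have x3: "x$3 = p * x$1 + q * x$2" using that by (simp add: a)
    then have "x$1 \<noteq> 0 \<or> x$2 \<noteq> 0" using that by (auto simp: vec3_simps)
    then have "(1 - (p\<^sup>2 + q\<^sup>2)) * ((x$1)\<^sup>2 + (x$2)\<^sup>2) > 0"
      using assms by (intro mult_pos_pos) (auto simp: sum_power2_gt_zero_iff)
    moreover have "lorentz x x = (1 - (p\<^sup>2 + q\<^sup>2)) * ((x$1)\<^sup>2 + (x$2)\<^sup>2) + (p * x$2 - q * x$1)\<^sup>2"
      unfolding lorentz_def x3 by algebra
    ultimately show ?thesis by (smt (verit) zero_le_power2)
  qed
  moreover have "{x. x$3 = p * x$1 + q * x$2 + c} = (\<lambda>x. vector [0, 0, c] + x) ` ?V"
  proof (intro equalityI subsetI)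
    fix x :: "real^3" assume "x \<in> {x. x$3 = p * x$1 + q * x$2 + c}"
    then show "x \<in> (\<lambda>x. vector [0, 0, c] + x) ` ?V"
      by (intro image_eqI[of _ _ "x - vector [0, 0, c]"]) (auto simp: a vector_3)
  qed (auto simp: a vector_3)
  ultimately show ?thesis unfolding spacelike_plane_def
    using subspace_hyperplane[of ?a] by blast
qed

text \<open>The direction space contains no vertical vector, as that would be timelike; hence its
  Euclidean normal has nonzero third coordinate and the plane is a graph.\<close>

lemma spacelike_plane_graphE:
  assumes "spacelike_plane P"
  obtains p q c where "p\<^sup>2 + q\<^sup>2 < 1" "P \<subseteq> {x. x$3 = p * x$1 + q * x$2 + c}"
proof -
  obtain o' V where V: "subspace V" "dim V = 2" "\<And>x. x \<in> V \<Longrightarrow> x \<noteq> 0 \<Longrightarrow> lorentz x x > 0"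
    and P: "P = (\<lambda>x. o' + x) ` V" using assms unfolding spacelike_plane_def by blast
  obtain a where a: "a \<noteq> 0" "span V \<subseteq> {x. a \<bullet> x = 0}"
    using lowdim_subset_hyperplane[of V] V(2) by auto
  have Va: "V = {x. a \<bullet> x = 0}"
    using a V(1,2) by (intro subspace_dim_equal subspace_hyperplane) (auto simp: dim_hyperplane span_eq_iff[THEN iffD2])
  have ai: "a \<bullet> x = a$1 * x$1 + a$2 * x$2 + a$3 * x$3" for x by (simp add: vec3_simps)
  have a3: "a$3 \<noteq> 0"
  proof
    assume "a$3 = 0"
    then have "vector [0, 0, 1] \<in> V" by (simp add: Va ai vector_3)
    from V(3)[OF this] show False by (simp add: lorentz_def vec3_simps)
  qed
  define p q where "p = - a$1 / a$3" and "q = - a$2 / a$3"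
  have eq: "x$3 = p * x$1 + q * x$2" if "x \<in> V" for x
    using that a3 by (simp add: Va ai p_def q_def field_simps)
  have "p\<^sup>2 + q\<^sup>2 < 1"
  proof (cases "p = 0 \<and> q = 0")
    case False
    \<comment> \<open>The direction of steepest ascent; its positive Lorentz square bounds the
      gradient.\<close>
    have "vector [p, q, p\<^sup>2 + q\<^sup>2] \<in> V" using a3
      by (simp add: Va ai vector_3 p_def q_def field_simps power2_eq_square)
    then have "p\<^sup>2 + q\<^sup>2 - (p\<^sup>2 + q\<^sup>2)\<^sup>2 > 0"
      using V(3)[of "vector [p, q, p\<^sup>2 + q\<^sup>2]"] False by (auto simp: lorentz_def vec3_simps power2_eq_square)
    then have "(p\<^sup>2 + q\<^sup>2) * (1 - (p\<^sup>2 + q\<^sup>2)) > 0" by (simp add: algebra_simps power2_eq_square)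
    then show ?thesis using sum_power2_ge_zero[of p q] by (auto simp: zero_less_mult_iff)
  qed auto
  moreover have "P \<subseteq> {x. x$3 = p * x$1 + q * x$2 + (o'$3 - p * o'$1 - q * o'$2)}"
    using eq by (auto simp: P algebra_simps)
  ultimately show ?thesis using that by blast
qed

section \<open>Common tangents of two circles\<close>

lemma common_tangents_normal_oline_iff:
  assumes "n1\<^sup>2 + n2\<^sup>2 = 1" "a \<in> E2" "a' \<in> E2"
  shows "normal_oline n1 n2 h \<in> common_tangents (a, r) (a', r') \<longleftrightarrow>
    n1 * a$1 + n2 * a$2 + r = h \<and> n1 * a'$1 + n2 * a'$2 + r' = h"
  using assms by (auto simp: common_tangents_def circle_contact_normal_oline E2_oline_iff)

text \<open>The witness is the mirror image of the normal in the line spanned by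
  \<open>(x, y)\<close>; \<open>c\<close> is the coefficient of the orthogonal projection to that
  line.\<close>

lemma unit_reflectE:
  fixes n1 n2 x y :: real
  assumes "n1\<^sup>2 + n2\<^sup>2 = 1" "x \<noteq> 0 \<or> y \<noteq> 0"
  obtains m1 m2 where "m1\<^sup>2 + m2\<^sup>2 = 1" "m1 * x + m2 * y = n1 * x + n2 * y"
    "m1 * y - m2 * x = - (n1 * y - n2 * x)"
proof
  define d where "d = x\<^sup>2 + y\<^sup>2"
  have d: "d \<noteq> 0" using assms(2) by (auto simp: d_def sum_power2_eq_zero_iff)
  define c where "c = (n1 * x + n2 * y) / d"
  have cd: "c * (x\<^sup>2 + y\<^sup>2) = n1 * x + n2 * y" using d by (simp add: c_def flip: d_def)
  show "(2 * c * x - n1)\<^sup>2 + (2 * c * y - n2)\<^sup>2 = 1"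
    "(2 * c * x - n1) * x + (2 * c * y - n2) * y = n1 * x + n2 * y"
    using assms(1) cd by algebra+
  show "(2 * c * x - n1) * y - (2 * c * y - n2) * x = - (n1 * y - n2 * x)"
    by (simp add: algebra_simps)
qed

lemma unit_eqI:
  fixes n1 n2 x y :: real
  assumes "x \<noteq> 0 \<or> y \<noteq> 0" "m1 * x + m2 * y = n1 * x + n2 * y" "m1 * y - m2 * x = n1 * y - n2 * x"
  shows "m1 = n1" "m2 = n2"
proof -
  have d: "x\<^sup>2 + y\<^sup>2 \<noteq> 0" using assms(1) by (auto simp: sum_power2_eq_zero_iff)
  have "(m1 - n1) * (x\<^sup>2 + y\<^sup>2) = 0" "(m2 - n2) * (x\<^sup>2 + y\<^sup>2) = 0" using assms(2,3) by algebra+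
  then show "m1 = n1" "m2 = n2" using d by auto
qed

text \<open>By Lagrange's identity the squares of the inner and the cross product with
  \<open>(x, y)\<close> add up to \<open>x\<^sup>2 + y\<^sup>2\<close> for every unit
  vector.\<close>

lemma unit_cross_cases:
  fixes n1 n2 x y :: real
  assumes "n1\<^sup>2 + n2\<^sup>2 = 1" "m1\<^sup>2 + m2\<^sup>2 = 1" "m1 * x + m2 * y = n1 * x + n2 * y"
  shows "m1 * y - m2 * x = n1 * y - n2 * x \<or> m1 * y - m2 * x = - (n1 * y - n2 * x)"
proof -
  have "(m1 * y - m2 * x)\<^sup>2 = (n1 * y - n2 * x)\<^sup>2" using assms by algebra
  then show ?thesis by (simp add: power2_eq_iff)
qed

text \<open>The coordinate along the rotated normal \<open>(- n2, n1)\<close>, which determines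
  heights on a lifted line.\<close>

definition tangential :: "real \<Rightarrow> real \<Rightarrow> real^3 \<Rightarrow> real" where
  "tangential n1 n2 x = n1 * x$2 - n2 * x$1"

text \<open>Mirroring the first tangent in the line of centers gives a common tangent again, which
  must be one of the two listed.\<close>

lemma common_tangents_opposite:
  assumes n: "n1\<^sup>2 + n2\<^sup>2 = 1" "m1\<^sup>2 + m2\<^sup>2 = 1" and E: "a \<in> E2" "a' \<in> E2"
    and ct: "common_tangents (a, r) (a', r') = {normal_oline n1 n2 h, normal_oline m1 m2 g}"
  shows "tangential m1 m2 a' - tangential m1 m2 a = - (tangential n1 n2 a' - tangential n1 n2 a)"
proof -
  define x y where "x = a'$1 - a$1" and "y = a'$2 - a$2"
  have n': "n1 * a$1 + n2 * a$2 + r = h" "n1 * a'$1 + n2 * a'$2 + r' = h"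
    using common_tangents_normal_oline_iff[OF n(1) E, of h r r'] ct by auto
  have m': "m1 * a$1 + m2 * a$2 + r = g" "m1 * a'$1 + m2 * a'$2 + r' = g"
    using common_tangents_normal_oline_iff[OF n(2) E, of g r r'] ct by auto
  have "m1 * y - m2 * x = - (n1 * y - n2 * x)"
  proof (cases "x = 0 \<and> y = 0")
    case False
    then obtain k1 k2 where k: "k1\<^sup>2 + k2\<^sup>2 = 1" "k1 * x + k2 * y = n1 * x + n2 * y"
      "k1 * y - k2 * x = - (n1 * y - n2 * x)" using unit_reflectE[OF n(1), of x y] by blast
    have "k1 * a'$1 + k2 * a'$2 + r' = k1 * a$1 + k2 * a$2 + r"
      using k(2) n' unfolding x_def y_def by (simp add: algebra_simps)
    then have "normal_oline k1 k2 (k1 * a$1 + k2 * a$2 + r) \<in> {normal_oline n1 n2 h, normal_oline m1 m2 g}"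
      unfolding ct[symmetric] common_tangents_normal_oline_iff[OF k(1) E] by simp
    then consider "k1 = n1" "k2 = n2" | "k1 = m1" "k2 = m2"
      using normal_oline_eqD[OF k(1) n(1)] normal_oline_eqD[OF k(1) n(2)] by blast
    then show ?thesis
    proof cases
      case 1
      \<comment> \<open>Here the first tangent is its own mirror image, so its tangential difference
        is zero, and that of the second agrees with it up to sign.\<close>
      have "m1 * x + m2 * y = n1 * x + n2 * y"
        using n' m' unfolding x_def y_def by (simp add: algebra_simps)
      from unit_cross_cases[OF n this] show ?thesis using k(3) 1 by auto
    qed (use k in simp)
  qed auto
  then show ?thesis by (simp add: tangential_def x_def y_def algebra_simps)
qed

text \<open>Equal centers force equal radii. Then every unit normal yields a common tangent, and
  three different normals do not fit into a set of at most two tangents.\<close>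

lemma common_tangents_centers_neq:
  assumes n: "n1\<^sup>2 + n2\<^sup>2 = 1" "m1\<^sup>2 + m2\<^sup>2 = 1" and E: "a \<in> E2" "a' \<in> E2"
    and ct: "common_tangents (a, r) (a', r') = {normal_oline n1 n2 h, normal_oline m1 m2 g}"
  shows "a \<noteq> a'"
proof
  assume aa: "a = a'"
  have "r = r'" using common_tangents_normal_oline_iff[OF n(1) E, of h r r'] ct aa by auto
  then have *: "(n1 = k1 \<and> n2 = k2) \<or> (m1 = k1 \<and> m2 = k2)" if k: "k1\<^sup>2 + k2\<^sup>2 = 1" for k1 k2
  proof -
    have "normal_oline k1 k2 (k1 * a$1 + k2 * a$2 + r) \<in> {normal_oline n1 n2 h, normal_oline m1 m2 g}"
      unfolding ct[symmetric] common_tangents_normal_oline_iff[OF k E] using aa \<open>r = r'\<close> by simp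
    then show ?thesis using normal_oline_eqD[OF k n(1)] normal_oline_eqD[OF k n(2)] by blast
  qed
  have "(n1 = 1 \<and> n2 = 0) \<or> (m1 = 1 \<and> m2 = 0)" "(n1 = 0 \<and> n2 = 1) \<or> (m1 = 0 \<and> m2 = 1)"
    "(n1 = - 1 \<and> n2 = 0) \<or> (m1 = - 1 \<and> m2 = 0)" by (rule *; simp)+
  then show False by linarith
qed

text \<open>Contact with both circles prescribes the inner product of the normal with the difference
  of centers; the only unit solutions are \<open>n\<close> and its mirror image \<open>m\<close>,
  which may coincide.\<close>

lemma common_tangents_reflect:
  assumes n: "n1\<^sup>2 + n2\<^sup>2 = 1" "m1\<^sup>2 + m2\<^sup>2 = 1" and E: "a \<in> E2" "a' \<in> E2" and aa: "a \<noteq> a'"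
    and n': "n1 * a$1 + n2 * a$2 + r = h" "n1 * a'$1 + n2 * a'$2 + r' = h"
    and m': "m1 * a$1 + m2 * a$2 + r = g" "m1 * a'$1 + m2 * a'$2 + r' = g"
    and opp: "tangential m1 m2 a' - tangential m1 m2 a = - (tangential n1 n2 a' - tangential n1 n2 a)"
  shows "common_tangents (a, r) (a', r') = {normal_oline n1 n2 h, normal_oline m1 m2 g}"
proof (intro equalityI subsetI)
  fix T assume T: "T \<in> common_tangents (a, r) (a', r')"
  then obtain k1 k2 l where k: "k1\<^sup>2 + k2\<^sup>2 = 1" and T': "T = normal_oline k1 k2 l"
    unfolding common_tangents_def E2_oline_iff by blast
  have k': "k1 * a$1 + k2 * a$2 + r = l" "k1 * a'$1 + k2 * a'$2 + r' = l"
    using T unfolding T' common_tangents_normal_oline_iff[OF k E] by auto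
  define x y where "x = a'$1 - a$1" and "y = a'$2 - a$2"
  have xy: "x \<noteq> 0 \<or> y \<noteq> 0" using aa E by (auto simp: x_def y_def E2_def vec3_simps)
  have kn: "k1 * x + k2 * y = n1 * x + n2 * y" and km: "k1 * x + k2 * y = m1 * x + m2 * y"
    using n' m' k' unfolding x_def y_def by (simp_all add: algebra_simps)
  have opp': "m1 * y - m2 * x = - (n1 * y - n2 * x)"
    using opp by (simp add: tangential_def x_def y_def algebra_simps)
  have "(k1 = n1 \<and> k2 = n2) \<or> (k1 = m1 \<and> k2 = m2)"
    using unit_cross_cases[OF n(1) k kn] unit_eqI[OF xy kn] unit_eqI[OF xy km] opp' by metis
  then show "T \<in> {normal_oline n1 n2 h, normal_oline m1 m2 g}" using n' m' k' T' by auto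
qed (use n n' m' E in \<open>auto simp: common_tangents_normal_oline_iff\<close>)

section \<open>Potentials on the square lattice\<close>

lemma int_potential:
  fixes a :: "int \<Rightarrow> real"
  shows "\<exists>z. z 0 = 0 \<and> (\<forall>i. z (i + 1) - z i = a i)"
proof (intro exI conjI allI)
  \<comment> \<open>A signed sum from 0 to \<open>i - 1\<close>: at most one of the two index sets
    is nonempty.\<close>
  let ?z = "\<lambda>i. (\<Sum>k\<in>{0..<i}. a k) - (\<Sum>k\<in>{i..<0}. a k)"
  fix i :: int
  show "?z (i + 1) - ?z i = a i"
  proof (cases "i \<ge> 0")
    case True
    then have "{0..<i + 1} = insert i {0..<i}" "{i..<0} = {}" "{i + 1..<0} = {}" by auto
    then show ?thesis by simp
  next
    case False
    then have "{i..<0} = insert i {i + 1..<0}" "{0..<i} = {}" "{0..<i + 1} = {}" by auto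
    then show ?thesis by simp
  qed
qed simp

text \<open>Discrete Poincare lemma: integrate along the row \<open>j = 0\<close>, then up and down
  the columns. Closedness around each square carries the horizontal differences from row to
  row.\<close>

lemma lattice_potential:
  fixes H V :: "int \<Rightarrow> int \<Rightarrow> real"
  assumes "\<And>i j. H i j + V (i + 1) j = V i j + H i (j + 1)"
  obtains Z where "\<And>i j. Z (i + 1, j) - Z (i, j) = H i j" "\<And>i j. Z (i, j + 1) - Z (i, j) = V i j"
proof -
  obtain x where x: "\<And>i. x (i + 1) - x i = H i 0" using int_potential[of "\<lambda>i. H i 0"] by blast
  obtain y where y: "\<And>i. y i 0 = 0" "\<And>i j. y i (j + 1) - y i j = V i j"
  proof -
    have "\<forall>i. \<exists>y. y 0 = 0 \<and> (\<forall>j. y (j + 1) - y j = V i j)"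
      using int_potential by blast
    then show ?thesis using that by metis
  qed
  let ?Z = "\<lambda>(i, j). x i + y i j"
  have "?Z (i + 1, j) - ?Z (i, j) = H i j" for i j
  proof (induction j rule: int_induct[where k = 0])
    case base
    then show ?case using x y(1) by simp
  next
    case (step1 j)
    then show ?case using y(2)[of i j] y(2)[of "i + 1" j] assms[of i j] by simp
  next
    case (step2 j)
    then show ?case using y(2)[of i "j - 1"] y(2)[of "i + 1" "j - 1"] assms[of i "j - 1"] by simp
  qed
  then show ?thesis using that[of ?Z] y(2) by simp
qed

section \<open>Faces at an edge and gluing of heights given on faces\<close>

lemma in_face_vertices_iff:
  "(i, j) \<in> face_vertices (k, l) \<longleftrightarrow> (i = k \<or> i = k + 1) \<and> (j = l \<or> j = l + 1)"
  by (auto simp: face_vertices_def)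

lemma faces_at_edge:
  "{f. {(i, j), (i + 1, j)} \<subseteq> face_vertices f} = {(i, j), (i, j - 1)}"
  "{f. {(i, j), (i, j + 1)} \<subseteq> face_vertices f} = {(i, j), (i - 1, j)}"
  by (auto simp: in_face_vertices_iff)

text \<open>Functions given on single faces, with equal differences along shared edges, glue up to
  one constant per face. Closedness holds since all four differences around a square can be read off
  from that face.\<close>

lemma face_potential:
  fixes \<tau> :: "face \<Rightarrow> vertex \<Rightarrow> real"
  assumes edge: "\<And>f f' z z'. adjacent z z' \<Longrightarrow> {f. {z, z'} \<subseteq> face_vertices f} = {f, f'} \<Longrightarrow> f \<noteq> f' \<Longrightarrow>
      \<tau> f z' - \<tau> f z = \<tau> f' z' - \<tau> f' z"
  obtains Z k where "\<And>f v. v \<in> face_vertices f \<Longrightarrow> Z v = \<tau> f v + k f"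
proof -
  define H V where "H i j = \<tau> (i, j) (i + 1, j) - \<tau> (i, j) (i, j)"
    and "V i j = \<tau> (i, j) (i, j + 1) - \<tau> (i, j) (i, j)" for i j
  have H: "H i j = \<tau> (i, j - 1) (i + 1, j) - \<tau> (i, j - 1) (i, j)" for i j
    unfolding H_def by (rule edge[OF _ faces_at_edge(1)]) (simp_all add: adjacent_def)
  have V: "V i j = \<tau> (i - 1, j) (i, j + 1) - \<tau> (i - 1, j) (i, j)" for i j
    unfolding V_def by (rule edge[OF _ faces_at_edge(2)]) (simp_all add: adjacent_def)
  have "H i j + V (i + 1) j = V i j + H i (j + 1)" for i j
    using V[of "i + 1" j] H[of i "j + 1"] by (simp add: H_def V_def)
  then obtain Z where Z: "\<And>i j. Z (i + 1, j) - Z (i, j) = H i j" "\<And>i j. Z (i, j + 1) - Z (i, j) = V i j"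
    using lattice_potential by metis
  show ?thesis
  proof
    fix f v assume v: "v \<in> face_vertices f"
    obtain i j where f: "f = (i, j)" by (cases f)
    have "Z (i + 1, j + 1) - Z (i, j + 1) = \<tau> (i, j) (i + 1, j + 1) - \<tau> (i, j) (i, j + 1)"
      using Z(1)[of i "j + 1"] H[of i "j + 1"] by simp
    then show "Z v = \<tau> f v + (Z f - \<tau> f f)"
      using v Z(1)[of i j] Z(2)[of i j] by (auto simp: f face_vertices_def H_def V_def)
  qed
qed

section \<open>Checkerboard signs of the faces\<close>

definition face_sign :: "face \<Rightarrow> real" where
  "face_sign f = (if even (fst f + snd f) then 1 else - 1)"

lemma face_sign_squared: "(face_sign f)\<^sup>2 = 1"
  by (simp add: face_sign_def)

lemma face_sign_opposite:
  assumes "adjacent z z'" "{f. {z, z'} \<subseteq> face_vertices f} = {f, f'}" "f \<noteq> f'"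
  shows "face_sign f' = - face_sign f"
proof -
  obtain i j i' j' where z: "z = (i, j)" "z' = (i', j')" by (cases z, cases z')
  have "(i' = i + 1 \<and> j' = j) \<or> (i = i' + 1 \<and> j' = j) \<or> (i' = i \<and> j' = j + 1) \<or> (i' = i \<and> j = j' + 1)"
    using assms(1) by (auto simp: adjacent_def z)
  then consider "{f, f'} = {(i, j), (i, j - 1)}" | "{f, f'} = {(i', j), (i', j - 1)}"
    | "{f, f'} = {(i, j), (i - 1, j)}" | "{f, f'} = {(i, j'), (i - 1, j')}"
    using assms(2) faces_at_edge[of i j] faces_at_edge[of i' j'] unfolding z
    by (elim disjE) (auto simp: insert_commute)
  then show ?thesis using assms(3) by cases (auto simp: doubleton_eq_iff face_sign_def)
qed

section \<open>Cycle patterns in normal form\<close>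

lemma pattern_normalsE:
  assumes "cycle_pattern (u, uF)"
  obtains n1 n2 h where "\<And>f. (n1 f)\<^sup>2 + (n2 f)\<^sup>2 = 1" "\<And>f. uF f = normal_oline (n1 f) (n2 f) (h f)"
    "\<And>f v. v \<in> face_vertices f \<Longrightarrow> n1 f * fst (u v)$1 + n2 f * fst (u v)$2 + snd (u v) = h f"
proof -
  have "\<forall>f. \<exists>n1 n2 h. n1\<^sup>2 + n2\<^sup>2 = 1 \<and> uF f = normal_oline n1 n2 h"
    using assms by (auto simp: E2_oline_iff)
  then obtain n1 n2 h where n: "\<And>f. (n1 f)\<^sup>2 + (n2 f)\<^sup>2 = 1" "\<And>f. uF f = normal_oline (n1 f) (n2 f) (h f)"
    by metis
  have "n1 f * fst (u v)$1 + n2 f * fst (u v)$2 + snd (u v) = h f" if "v \<in> face_vertices f" for f v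
  proof -
    have "circle_contact (fst (u v), snd (u v)) (uF f)" "fst (u v) \<in> E2" using assms that by simp_all
    then show ?thesis unfolding n(2) using circle_contact_normal_oline[OF n(1)] by blast
  qed
  then show ?thesis using that n by blast
qed

text \<open>Across an edge both the tangential difference and the face sign are negated, so their
  product agrees on the two faces. This is the compatibility needed to integrate heights.\<close>

lemma edge_tangents_lift:
  assumes u: "\<And>v. fst (u v) \<in> E2" and n: "\<And>f. (n1 f)\<^sup>2 + (n2 f)\<^sup>2 = 1"
    and et: "edge_tangents (u, \<lambda>f. normal_oline (n1 f) (n2 f) (h f))"
    and zz: "adjacent z z'" "{f. {z, z'} \<subseteq> face_vertices f} = {f, f'}" "f \<noteq> f'"
  shows "face_sign f * tangential (n1 f) (n2 f) (fst (u z')) - face_sign f * tangential (n1 f) (n2 f) (fst (u z)) =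
    face_sign f' * tangential (n1 f') (n2 f') (fst (u z')) - face_sign f' * tangential (n1 f') (n2 f') (fst (u z))"
proof -
  have "common_tangents (fst (u z), snd (u z)) (fst (u z'), snd (u z')) =
    {normal_oline (n1 f) (n2 f) (h f), normal_oline (n1 f') (n2 f') (h f')}"
    using et zz(1,2) by simp
  from common_tangents_opposite[OF n n u u this] show ?thesis
    using face_sign_opposite[OF zz] by algebra
qed

section \<open>Points on one side of a line\<close>

lemma convex_combination_zeroE:
  fixes a b :: real
  assumes "a * b \<le> 0"
  obtains t where "0 \<le> t" "t \<le> 1" "(1 - t) * a + t * b = 0"
proof (cases "a = b")
  case True
  then have "a = 0" using assms by (metis mult_eq_0_iff order_antisym zero_le_square)
  then show ?thesis using that[of 0] by simp
next
  case False
  have "0 \<le> a / (a - b) \<and> a / (a - b) \<le> 1"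
    using assms False by (auto simp: divide_simps mult_le_0_iff)
  moreover have "(1 - a / (a - b)) * a + a / (a - b) * b = 0"
    using False by (simp add: field_simps)
  ultimately show ?thesis using that by blast
qed

text \<open>The cross product with the direction is an affine function vanishing on the line. If its
  values at the ends did not have strictly equal sign, it would vanish at a point of the
  segment.\<close>

lemma same_side_cross:
  assumes E: "a \<in> E2" "a' \<in> E2" "p \<in> E2" "q \<in> E2" and aa: "a \<noteq> a'"
    and disj: "closed_segment p q \<inter> affine hull {a, a'} = {}"
  shows "((a'$1 - a$1) * (p$2 - a$2) - (a'$2 - a$2) * (p$1 - a$1)) *
    ((a'$1 - a$1) * (q$2 - a$2) - (a'$2 - a$2) * (q$1 - a$1)) > 0"
proof (rule ccontr)
  let ?c = "\<lambda>p::real^3. (a'$1 - a$1) * (p$2 - a$2) - (a'$2 - a$2) * (p$1 - a$1)"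
  assume "\<not> ?thesis"
  then have neg: "?c p * ?c q \<le> 0" by simp
  then obtain t where t: "0 \<le> t" "t \<le> 1" "(1 - t) * ?c p + t * ?c q = 0"
    using convex_combination_zeroE by blast
  define y where "y = (1 - t) *\<^sub>R p + t *\<^sub>R q"
  have cy: "?c y = 0" using t(3) unfolding y_def by (simp add: algebra_simps)
  have y3: "y$3 = 0" using E by (simp add: y_def E2_def)
  define x1 x2 where "x1 = a'$1 - a$1" and "x2 = a'$2 - a$2"
  define d where "d = x1\<^sup>2 + x2\<^sup>2"
  have d: "d \<noteq> 0" using E aa by (auto simp: d_def x1_def x2_def sum_power2_eq_zero_iff vec3_simps E2_def)
  \<comment> \<open>The parameter of the orthogonal projection of \<open>y\<close> to the
    line.\<close>
  define c where "c = (x1 * (y$1 - a$1) + x2 * (y$2 - a$2)) / d"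
  have cd: "c * d = x1 * (y$1 - a$1) + x2 * (y$2 - a$2)" using d by (simp add: c_def)
  have "d * (y$1 - a$1 - c * x1) = 0" "d * (y$2 - a$2 - c * x2) = 0"
    using cy cd unfolding x1_def[symmetric] x2_def[symmetric] d_def by algebra+
  then have "y$1 = a$1 + c * x1" "y$2 = a$2 + c * x2" using d by auto
  then have "y = (1 - c) *\<^sub>R a + c *\<^sub>R a'"
    using y3 E by (simp add: vec3_simps x1_def x2_def E2_def algebra_simps)
  moreover have "(1 - c) + c = 1" by simp
  ultimately have "y \<in> affine hull {a, a'}" unfolding affine_hull_2 by blast
  moreover have "y \<in> closed_segment p q" using t by (auto simp: y_def closed_segment_def)
  ultimately show False using disj by blast
qed

section \<open>Mirror images\<close>

lemma unit_decomposition: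
  fixes n1 n2 :: real
  assumes "n1\<^sup>2 + n2\<^sup>2 = 1"
  shows "(n1 * p1 + n2 * p2)\<^sup>2 + (n1 * p2 - n2 * p1)\<^sup>2 = p1\<^sup>2 + p2\<^sup>2"
  using assms by algebra

text \<open>The lifts of two points with coordinates \<open>p\<close> and \<open>q\<close> relative to a white center differ by a
  timelike vector iff the points are strictly on the same side of the line of centers, which has
  direction \<open>(x, y)\<close>.\<close>

lemma lorentz_mirror:
  fixes n1 n2 m1 m2 x y p1 p2 q1 q2 r :: real
  assumes "n1\<^sup>2 + n2\<^sup>2 = 1" "m1\<^sup>2 + m2\<^sup>2 = 1"
    and "m1 * x + m2 * y = n1 * x + n2 * y" "m1 * y - m2 * x = - (n1 * y - n2 * x)"
    and "n1 * p1 + n2 * p2 = r" "m1 * q1 + m2 * q2 = r"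
  shows "((p1 - q1)\<^sup>2 + (p2 - q2)\<^sup>2 - ((n1 * p2 - n2 * p1) + (m1 * q2 - m2 * q1))\<^sup>2) * (x\<^sup>2 + y\<^sup>2)
    = - 4 * ((x * p2 - y * p1) * (x * q2 - y * q1))"
proof -
  \<comment> \<open>In the frames of the two normals the direction has coordinates
    \<open>(\<alpha>, \<beta>)\<close> and \<open>(\<alpha>, - \<beta>)\<close>, and the points have
    coordinates \<open>(r, s)\<close> and \<open>(r, t)\<close>.\<close>
  define \<alpha> \<beta> s t where "\<alpha> = n1 * x + n2 * y" and "\<beta> = n1 * y - n2 * x"
    and "s = n1 * p2 - n2 * p1" and "t = m1 * q2 - m2 * q1"
  have L: "x\<^sup>2 + y\<^sup>2 = \<alpha>\<^sup>2 + \<beta>\<^sup>2" using assms(1) unfolding \<alpha>_def \<beta>_def by algebra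
  have m: "m1 * x + m2 * y = \<alpha>" "m1 * y - m2 * x = - \<beta>" using assms(3,4) by (auto simp: \<alpha>_def \<beta>_def)
  have p: "x * p2 - y * p1 = \<alpha> * s - \<beta> * r"
    using assms(1,5) unfolding \<alpha>_def \<beta>_def s_def by algebra
  have q: "x * q2 - y * q1 = \<alpha> * t + \<beta> * r"
    using assms(2,6) m unfolding t_def by algebra
  have p': "x * p1 + y * p2 = \<alpha> * r + \<beta> * s"
    using assms(1,5) unfolding \<alpha>_def \<beta>_def s_def by algebra
  have q': "x * q1 + y * q2 = \<alpha> * r - \<beta> * t"
    using assms(2,6) m unfolding t_def by algebra
  have "((p1 - q1)\<^sup>2 + (p2 - q2)\<^sup>2) * (x\<^sup>2 + y\<^sup>2) =
    ((x * p1 + y * p2) - (x * q1 + y * q2))\<^sup>2 + ((x * p2 - y * p1) - (x * q2 - y * q1))\<^sup>2"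
    by algebra
  then have "((p1 - q1)\<^sup>2 + (p2 - q2)\<^sup>2 - (s + t)\<^sup>2) * (x\<^sup>2 + y\<^sup>2) =
    - 4 * ((\<alpha> * s - \<beta> * r) * (\<alpha> * t + \<beta> * r))"
    unfolding p q p' q' L by algebra
  then show ?thesis by (simp only: p q s_def t_def)
qed

text \<open>With a white center as origin, \<open>t\<close> is the coefficient of the Lorentz
  reflection of \<open>(p1, p2, z)\<close> in the plane of gradient \<open>(p, q)\<close>, whose
  Lorentz normal is \<open>(p, q, 1)\<close>. The plane contains both white centers by the
  hypothesis on \<open>s\<close>, so the image is in contact with the mirrored tangent.\<close>

lemma mirror_tangent:
  fixes n1 n2 m1 m2 x y p1 p2 z r s p q t :: real
  assumes n: "n1\<^sup>2 + n2\<^sup>2 = 1" and m: "m1\<^sup>2 + m2\<^sup>2 = 1" and s: "s\<^sup>2 = 1"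
    and xy: "x \<noteq> 0 \<or> y \<noteq> 0"
    and mn: "m1 * x + m2 * y = n1 * x + n2 * y" "m1 * y - m2 * x = - (n1 * y - n2 * x)"
    and P: "n1 * p1 + n2 * p2 = r" "z = s * (n1 * p2 - n2 * p1)"
    and D: "s * (n1 * y - n2 * x) = p * x + q * y"
    and pq: "p\<^sup>2 + q\<^sup>2 < 1" and t: "t * (p\<^sup>2 + q\<^sup>2 - 1) = 2 * (p * p1 + q * p2 - z)"
  shows "m1 * (p1 - t * p) + m2 * (p2 - t * q) = r"
proof -
  \<comment> \<open>All quantities are multiplied by \<open>L\<close> and expressed by components
    along and across \<open>(x, y)\<close>.\<close>
  define \<alpha> \<beta> \<nu> L Pd Pc where "\<alpha> = n1 * x + n2 * y" and "\<beta> = n1 * y - n2 * x"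
    and "\<nu> = x * q - y * p" and "L = x\<^sup>2 + y\<^sup>2" and "Pd = x * p1 + y * p2" and "Pc = x * p2 - y * p1"
  have m': "m1 * x + m2 * y = \<alpha>" "m1 * y - m2 * x = - \<beta>" using mn by (auto simp: \<alpha>_def \<beta>_def)
  have D': "p * x + q * y = s * \<beta>" using D by (simp add: \<beta>_def)
  have L: "L \<noteq> 0" using xy by (auto simp: L_def sum_power2_eq_zero_iff)
  have 1: "L * (m1 * p + m2 * q) = \<beta> * (s * \<alpha> + \<nu>)"
  proof -
    have "L * (m1 * p + m2 * q) = (m1 * x + m2 * y) * (p * x + q * y) - (m1 * y - m2 * x) * (x * q - y * p)"
      unfolding L_def by algebra
    then show ?thesis unfolding m' D' \<nu>_def by algebra
  qed
  have 2: "L * (m1 * p1 + m2 * p2) = \<alpha> * Pd + \<beta> * Pc"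
  proof -
    have "L * (m1 * p1 + m2 * p2) = (m1 * x + m2 * y) * Pd - (m1 * y - m2 * x) * Pc"
      unfolding L_def Pd_def Pc_def by algebra
    then show ?thesis unfolding m' by algebra
  qed
  have 3: "L * r = \<alpha> * Pd - \<beta> * Pc"
    unfolding L_def Pd_def Pc_def \<alpha>_def \<beta>_def P(1)[symmetric] by algebra
  have 4: "L * (n1 * p2 - n2 * p1) = \<beta> * Pd + \<alpha> * Pc"
    unfolding L_def Pd_def Pc_def \<alpha>_def \<beta>_def by algebra
  have 5: "L * (p\<^sup>2 + q\<^sup>2 - 1) = \<nu>\<^sup>2 - \<alpha>\<^sup>2"
  proof -
    have "L * (p\<^sup>2 + q\<^sup>2) = (p * x + q * y)\<^sup>2 + \<nu>\<^sup>2" unfolding L_def \<nu>_def by algebra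
    moreover have "L = \<alpha>\<^sup>2 + \<beta>\<^sup>2" using n unfolding L_def \<alpha>_def \<beta>_def by algebra
    ultimately show ?thesis using s unfolding D' by algebra
  qed
  have 6: "L * (p * p1 + q * p2) = s * \<beta> * Pd + \<nu> * Pc"
  proof -
    have "L * (p * p1 + q * p2) = (p * x + q * y) * Pd + \<nu> * Pc"
      unfolding L_def \<nu>_def Pd_def Pc_def by algebra
    then show ?thesis unfolding D' .
  qed
  have "t * (L * (p\<^sup>2 + q\<^sup>2 - 1)) = 2 * (L * (p * p1 + q * p2) - s * (L * (n1 * p2 - n2 * p1)))"
    using t unfolding P(2) by algebra
  \<comment> \<open>The condition on \<open>t\<close> factors, as \<open>s\<^sup>2 = 1\<close>; the
    common factor is nonzero because the plane is spacelike.\<close>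
  then have eq: "(\<nu> - s * \<alpha>) * (t * (\<nu> + s * \<alpha>)) = (\<nu> - s * \<alpha>) * (2 * Pc)"
    using s unfolding 4 5 6 by algebra
  have "\<nu>\<^sup>2 - \<alpha>\<^sup>2 \<noteq> 0" using 5 L pq by (metis diff_gt_0_iff_gt less_irrefl mult_eq_0_iff eq_iff_diff_eq_0)
  then have "\<nu> - s * \<alpha> \<noteq> 0" using s by (auto simp: power_mult_distrib)
  then have tc: "t * (\<nu> + s * \<alpha>) = 2 * Pc" using eq by simp
  have "L * (m1 * (p1 - t * p) + m2 * (p2 - t * q)) = L * (m1 * p1 + m2 * p2) - t * (L * (m1 * p + m2 * q))"
    by algebra
  also have "\<dots> = L * r" using tc unfolding 1 2 3 by algebra
  finally show ?thesis using L by simp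
qed

section \<open>Projection of isothermic congruences\<close>

lemma white_vertices_cases:
  obtains w w' where "white_vertices f = {w, w'}" "w \<noteq> w'" "white w" "white w'"
    "w \<in> face_vertices f" "w' \<in> face_vertices f"
    "\<And>b. black b \<Longrightarrow> b \<in> face_vertices f \<Longrightarrow> adjacent b w \<and> adjacent b w'"
    "\<And>v. v \<in> face_vertices f \<Longrightarrow> \<not> black v \<Longrightarrow> v = w \<or> v = w'"
proof -
  obtain i j where f: "f = (i, j)" by (cases f)
  define w w' where "w = (if even (i + j) then (i + 1, j) else (i, j))"
    and "w' = (if even (i + j) then (i, j + 1) else (i + 1, j + 1))"
  show ?thesis
    by (rule that[of w w'])
      (auto simp: f white_vertices_def face_vertices_def white_def black_def adjacent_def w_def w'_def)
qed

lemma neighbour_in_face: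
  assumes "black b" "adjacent b w"
  shows "white w" "\<exists>f. b \<in> face_vertices f \<and> w \<in> white_vertices f"
proof -
  obtain i j k l where bw: "b = (i, j)" "w = (k, l)" by (cases b, cases w)
  have *: "(k = i + 1 \<and> l = j) \<or> (k = i \<and> l = j + 1) \<or> (k = i - 1 \<and> l = j) \<or> (k = i \<and> l = j - 1)"
    using assms(2) by (auto simp: adjacent_def bw)
  then show w: "white w" using assms(1) by (auto simp: bw black_def white_def)
  show "\<exists>f. b \<in> face_vertices f \<and> w \<in> white_vertices f"
    using * w unfolding white_vertices_def
    \<comment> \<open>One of the two faces at the edge, with the lower end of the edge as its
      corner.\<close>
    by (intro exI[of _ "(min i k, min j l)"]) (auto simp: bw in_face_vertices_iff)
qed

text \<open>Miquel dynamics is realized by mirroring: tangents in the planar lines of white centers,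
  black points by Lorentz reflection in the spacelike planes followed by projection.\<close>

lemma isothermic_congruence_projects:
  assumes iso: "isothermic_congruence (c, cF)" and gen: "generic_congruence (c, cF)"
  shows "isothermic_pattern (projected_pattern (c, cF))"
proof -
  have "\<forall>f. \<exists>n1 n2 s h k. n1\<^sup>2 + n2\<^sup>2 = 1 \<and> s\<^sup>2 = 1 \<and> cF f = lifted_oline n1 n2 s h k"
    using iso by (simp add: isotropic_oline_iff)
  then obtain n1 n2 s h k where n: "\<And>f. (n1 f)\<^sup>2 + (n2 f)\<^sup>2 = 1" and s: "\<And>f. (s f)\<^sup>2 = 1"
    and cF: "\<And>f. cF f = lifted_oline (n1 f) (n2 f) (s f) (h f) (k f)" by metis
  have contact: "n1 f * fst (c v)$1 + n2 f * fst (c v)$2 + snd (c v) = h f"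
      "fst (c v)$3 = s f * (n1 f * fst (c v)$2 - n2 f * fst (c v)$1) + k f"
    if "v \<in> face_vertices f" for f v
  proof -
    have "lsphere_contact (fst (c v), snd (c v)) (cF f)" using iso that by simp
    then show "n1 f * fst (c v)$1 + n2 f * fst (c v)$2 + snd (c v) = h f"
      "fst (c v)$3 = s f * (n1 f * fst (c v)$2 - n2 f * fst (c v)$1) + k f"
      unfolding cF lsphere_contact_lifted_oline[OF n s] by auto
  qed
  define u where "u v = (proj (fst (c v)), snd (c v))" for v
  have u: "fst (u v)$1 = fst (c v)$1" "fst (u v)$2 = fst (c v)$2" "fst (u v) \<in> E2" "snd (u v) = snd (c v)" for v
    by (auto simp: u_def proj_def E2_def vector_3)
  define uF where "uF f = normal_oline (n1 f) (n2 f) (h f)" for f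
  have proj: "projected_pattern (c, cF) = (u, uF)"
    by (simp add: u_def[abs_def] uF_def[abs_def] cF projected_lifted_oline[OF n])
  have b0: "snd (c b) = 0" if "black b" for b using iso that by simp
  have E2o: "E2_oline (normal_oline m1 m2 g)" if "m1\<^sup>2 + m2\<^sup>2 = 1" for m1 m2 g using that E2_oline_iff by blast
  have inc: "incircular_pattern (u, uF)"
    using contact(1) b0 u n E2o circle_contact_normal_oline[OF n u(3)]
    by (simp add: uF_def) (metis prod.collapse)
  have "\<forall>f. \<exists>w w'. white_vertices f = {w, w'} \<and> w \<noteq> w' \<and> white w \<and> white w' \<and>
    w \<in> face_vertices f \<and> w' \<in> face_vertices f \<and>
    (\<forall>b. black b \<longrightarrow> b \<in> face_vertices f \<longrightarrow> adjacent b w \<and> adjacent b w') \<and>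
    (\<forall>v. v \<in> face_vertices f \<longrightarrow> \<not> black v \<longrightarrow> v = w \<or> v = w')"
    by (rule allI, rule white_vertices_cases) blast
  then obtain w w' where w: "\<And>f. white_vertices f = {w f, w' f}" "\<And>f. w f \<noteq> w' f"
    "\<And>f. white (w f)" "\<And>f. white (w' f)" "\<And>f. w f \<in> face_vertices f" "\<And>f. w' f \<in> face_vertices f"
    and adj: "\<And>f b. black b \<Longrightarrow> b \<in> face_vertices f \<Longrightarrow> adjacent b (w f) \<and> adjacent b (w' f)"
    and fv: "\<And>f v. v \<in> face_vertices f \<Longrightarrow> \<not> black v \<Longrightarrow> v = w f \<or> v = w' f" by metis
  define x y where "x f = fst (c (w' f))$1 - fst (c (w f))$1"
    and "y f = fst (c (w' f))$2 - fst (c (w f))$2" for f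
  have Dz: "fst (c (w' f))$3 - fst (c (w f))$3 = s f * (n1 f * y f - n2 f * x f)" for f
    using contact(2)[OF w(5), of f] contact(2)[OF w(6), of f] by (simp add: x_def y_def algebra_simps)
  \<comment> \<open>White centers of a face with equal projections would have equal heights and
    radii, so the spheres would coincide.\<close>
  have xy: "x f \<noteq> 0 \<or> y f \<noteq> 0" for f
  proof (rule ccontr)
    assume 0: "\<not> ?thesis"
    then have "fst (c (w' f)) = fst (c (w f))" using Dz[of f] by (simp add: vec3_simps x_def y_def)
    moreover have "snd (c (w' f)) = snd (c (w f))"
      using contact(1)[OF w(5), of f] contact(1)[OF w(6), of f] 0 by (simp add: x_def y_def)
    ultimately have "c (w' f) = c (w f)" by (rule prod_eqI)
    moreover have "inj_on c (white_vertices f)" using gen unfolding generic_congruence_def by (metis fst_conv)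
    ultimately show False using w(1,2) by (metis inj_onD insertCI)
  qed
  have "\<forall>f. \<exists>m1 m2. m1\<^sup>2 + m2\<^sup>2 = 1 \<and> m1 * x f + m2 * y f = n1 f * x f + n2 f * y f \<and>
    m1 * y f - m2 * x f = - (n1 f * y f - n2 f * x f)"
    using unit_reflectE[OF n xy] by metis
  then obtain m1 m2 where m: "\<And>f. (m1 f)\<^sup>2 + (m2 f)\<^sup>2 = 1"
    and mn: "\<And>f. m1 f * x f + m2 f * y f = n1 f * x f + n2 f * y f"
    "\<And>f. m1 f * y f - m2 f * x f = - (n1 f * y f - n2 f * x f)" by metis
  define g where "g f = m1 f * fst (c (w f))$1 + m2 f * fst (c (w f))$2 + snd (c (w f))" for f
  have g': "m1 f * fst (c (w' f))$1 + m2 f * fst (c (w' f))$2 + snd (c (w' f)) = g f" for f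
    using mn(1)[of f] contact(1)[OF w(5), of f] contact(1)[OF w(6), of f]
    by (simp add: g_def x_def y_def algebra_simps)
  define vF where "vF f = normal_oline (m1 f) (m2 f) (g f)" for f
  have "\<forall>b. \<exists>p q d. black b \<longrightarrow> p\<^sup>2 + q\<^sup>2 < 1 \<and>
      (\<forall>w. adjacent b w \<longrightarrow> fst (c w)$3 = p * fst (c w)$1 + q * fst (c w)$2 + d)"
  proof
    fix b
    show "\<exists>p q d. black b \<longrightarrow> p\<^sup>2 + q\<^sup>2 < 1 \<and>
      (\<forall>w. adjacent b w \<longrightarrow> fst (c w)$3 = p * fst (c w)$1 + q * fst (c w)$2 + d)"
    proof (cases "black b")
      case True
      then obtain P where P: "spacelike_plane P" "\<And>w. adjacent b w \<Longrightarrow> fst (c w) \<in> P" using iso by auto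
      from P(1) show ?thesis by (rule spacelike_plane_graphE) (use P(2) in blast)
    qed simp
  qed
  then obtain p q d where pq: "\<And>b. black b \<Longrightarrow> (p b)\<^sup>2 + (q b)\<^sup>2 < 1"
    and plane: "\<And>b w. black b \<Longrightarrow> adjacent b w \<Longrightarrow> fst (c w)$3 = p b * fst (c w)$1 + q b * fst (c w)$2 + d b"
    by metis
  \<comment> \<open>The coefficient of the Lorentz reflection; at a black vertex the denominator is
    negative since the plane is spacelike.\<close>
  define t where "t b = 2 * (p b * fst (c b)$1 + q b * fst (c b)$2 + d b - fst (c b)$3) / ((p b)\<^sup>2 + (q b)\<^sup>2 - 1)" for b
  \<comment> \<open>The projection of the mirror image of the black center in the plane of the adjacent white
    centers.\<close>
  define v where "v z = (if black z
    then (vector [fst (c z)$1 - t z * p z, fst (c z)$2 - t z * q z, 0], 0) else u z)" for z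
  have vw: "v z = u z" if "white z" for z using that by (simp add: v_def black_def white_def)
  have vE: "fst (v z) \<in> E2" for z using u by (simp add: v_def E2_def vector_3)
  have vcontact: "circle_contact (v z) (vF f)" if z: "z \<in> face_vertices f" for f z
  proof -
    have "m1 f * fst (v z)$1 + m2 f * fst (v z)$2 + snd (v z) = g f"
    proof (cases "black z")
      case False
      then show ?thesis using fv[OF z] g'[of f] u[of z] by (auto simp: v_def g_def)
    next
      case True
      let ?a = "fst (c (w f))" and ?b = "fst (c z)"
      have tz: "t z * ((p z)\<^sup>2 + (q z)\<^sup>2 - 1) = 2 * (p z * ?b$1 + q z * ?b$2 + d z - ?b$3)"
        using pq[OF True] by (simp add: t_def)
      have pa: "?a$3 = p z * ?a$1 + q z * ?a$2 + d z" using plane adj True z by blast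
      have pa': "fst (c (w' f))$3 = p z * fst (c (w' f))$1 + q z * fst (c (w' f))$2 + d z"
        using plane adj True z by blast
      \<comment> \<open>Coordinates are relative to a white center, so that the plane passes through
        the origin.\<close>
      have "m1 f * ((?b$1 - ?a$1) - t z * p z) + m2 f * ((?b$2 - ?a$2) - t z * q z) = snd (c (w f))"
      proof (rule mirror_tangent[OF n m s xy mn, where z = "?b$3 - ?a$3" and p = "p z" and q = "q z"])
        show "n1 f * (?b$1 - ?a$1) + n2 f * (?b$2 - ?a$2) = snd (c (w f))"
          using contact(1)[OF z] contact(1)[OF w(5), of f] b0[OF True] by (simp add: algebra_simps)
        show "?b$3 - ?a$3 = s f * (n1 f * (?b$2 - ?a$2) - n2 f * (?b$1 - ?a$1))"
          using contact(2)[OF z] contact(2)[OF w(5), of f] by (simp add: algebra_simps)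
        show "s f * (n1 f * y f - n2 f * x f) = p z * x f + q z * y f"
          using Dz[of f] pa pa' by (simp add: x_def y_def algebra_simps)
        show "(p z)\<^sup>2 + (q z)\<^sup>2 < 1" by (rule pq[OF True])
        show "t z * ((p z)\<^sup>2 + (q z)\<^sup>2 - 1) =
          2 * (p z * (?b$1 - ?a$1) + q z * (?b$2 - ?a$2) - (?b$3 - ?a$3))"
          unfolding tz pa by (simp add: algebra_simps)
      qed
      then show ?thesis using True by (simp add: v_def g_def vector_3 algebra_simps)
    qed
    then show ?thesis using circle_contact_normal_oline[OF m vE, of z "snd (v z)" f "g f"] by (simp add: vF_def)
  qed
  have vinc: "incircular_pattern (v, vF)"
    using vE vcontact E2o[OF m] by (simp add: vF_def v_def)
  have ct: "common_tangents (u (w f)) (u (w' f)) = {uF f, vF f}" for f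
  proof -
    have "common_tangents (fst (u (w f)), snd (u (w f))) (fst (u (w' f)), snd (u (w' f))) = {uF f, vF f}"
      unfolding uF_def vF_def
    proof (rule common_tangents_reflect[OF n m u(3) u(3)])
      show "fst (u (w f)) \<noteq> fst (u (w' f))" using xy[of f] u unfolding x_def y_def by (metis cancel_comm_monoid_add_class.diff_cancel)
      show "tangential (m1 f) (m2 f) (fst (u (w' f))) - tangential (m1 f) (m2 f) (fst (u (w f))) =
        - (tangential (n1 f) (n2 f) (fst (u (w' f))) - tangential (n1 f) (n2 f) (fst (u (w f))))"
        using mn(2)[of f] u by (simp add: tangential_def x_def y_def algebra_simps)
    qed (use contact(1)[OF w(5), of f] contact(1)[OF w(6), of f] g'[of f] u in \<open>simp_all add: g_def\<close>)
    then show ?thesis by simp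
  qed
  have comm: "common_tangents C C' = common_tangents C' C" for C C' by (auto simp: common_tangents_def)
  have "miquel (u, uF) (v, vF)"
    using vinc vw w(1) ct comm by simp
  then show ?thesis unfolding proj isothermic_pattern_def using inc vinc by blast
qed

section \<open>Lift of isothermic patterns\<close>

text \<open>If the lifts of \<open>u b\<close> and \<open>v b\<close> differ by a timelike vector,
  the white centers lie in the Lorentz bisector plane of these lifts. Otherwise the side condition
  forces both points and both heights to agree, and the white centers lie on one spacelike
  line.\<close>

lemma lift_spacelike:
  fixes u v :: "vertex \<Rightarrow> ocircle" and Z :: "vertex \<Rightarrow> real" and n1 n2 h m1 m2 g k :: "face \<Rightarrow> real"
  assumes n: "\<And>f. (n1 f)\<^sup>2 + (n2 f)\<^sup>2 = 1" and m: "\<And>f. (m1 f)\<^sup>2 + (m2 f)\<^sup>2 = 1"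
    and cu: "\<And>f z. z \<in> face_vertices f \<Longrightarrow> n1 f * fst (u z)$1 + n2 f * fst (u z)$2 + snd (u z) = h f"
    and cv: "\<And>f z. z \<in> face_vertices f \<Longrightarrow> m1 f * fst (v z)$1 + m2 f * fst (v z)$2 + snd (v z) = g f"
    and Z: "\<And>f z. z \<in> face_vertices f \<Longrightarrow> Z z = face_sign f * tangential (n1 f) (n2 f) (fst (u z)) + k f"
    and vw: "\<And>w. white w \<Longrightarrow> v w = u w"
    and opp: "\<And>f w w'. w \<in> white_vertices f \<Longrightarrow> w' \<in> white_vertices f \<Longrightarrow> w \<noteq> w' \<Longrightarrow>
      tangential (m1 f) (m2 f) (fst (u w')) - tangential (m1 f) (m2 f) (fst (u w)) =
      - (tangential (n1 f) (n2 f) (fst (u w')) - tangential (n1 f) (n2 f) (fst (u w)))"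
    and edge: "\<And>f f' z z'. adjacent z z' \<Longrightarrow> {f. {z, z'} \<subseteq> face_vertices f} = {f, f'} \<Longrightarrow> f \<noteq> f' \<Longrightarrow>
      face_sign f * tangential (m1 f) (m2 f) (fst (v z')) - face_sign f * tangential (m1 f) (m2 f) (fst (v z)) =
      face_sign f' * tangential (m1 f') (m2 f') (fst (v z')) - face_sign f' * tangential (m1 f') (m2 f') (fst (v z))"
    and side: "\<And>f b w w'. black b \<Longrightarrow> b \<in> face_vertices f \<Longrightarrow> w \<in> white_vertices f \<Longrightarrow>
      w' \<in> white_vertices f \<Longrightarrow> w \<noteq> w' \<Longrightarrow> fst (u b) = fst (v b) \<or>
      ((fst (u w')$1 - fst (u w)$1) * (fst (u b)$2 - fst (u w)$2) - (fst (u w')$2 - fst (u w)$2) * (fst (u b)$1 - fst (u w)$1)) *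
      ((fst (u w')$1 - fst (u w)$1) * (fst (v b)$2 - fst (u w)$2) - (fst (u w')$2 - fst (u w)$2) * (fst (v b)$1 - fst (u w)$1)) > 0"
    and r: "\<And>w. white w \<Longrightarrow> snd (u w) \<noteq> 0" "snd (u b) = 0" "snd (v b) = 0"
    and b: "black b"
  obtains p q d where "p\<^sup>2 + q\<^sup>2 < 1" "\<And>w. adjacent b w \<Longrightarrow> Z w = p * fst (u w)$1 + q * fst (u w)$2 + d"
proof -
  obtain i j where bij: "b = (i, j)" by (cases b)
  define F1 F2 F3 F4 :: face where "F1 = (i, j)" and "F2 = (i - 1, j)" and "F3 = (i - 1, j - 1)" and "F4 = (i, j - 1)"
  define e1 e2 e3 e4 :: vertex where "e1 = (i + 1, j)" and "e2 = (i, j + 1)" and "e3 = (i - 1, j)" and "e4 = (i, j - 1)"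
  note defs = F1_def F2_def F3_def F4_def e1_def e2_def e3_def e4_def
  have wv: "white_vertices F1 = {e1, e2}" "white_vertices F2 = {e2, e3}"
      "white_vertices F3 = {e3, e4}" "white_vertices F4 = {e4, e1}"
    using b by (auto simp: defs bij white_vertices_def face_vertices_def white_def black_def)
  have neq: "e1 \<noteq> e2" "e2 \<noteq> e3" "e3 \<noteq> e4" "e4 \<noteq> e1" by (auto simp: defs)
  have bF: "b \<in> face_vertices f \<longleftrightarrow> f = F1 \<or> f = F2 \<or> f = F3 \<or> f = F4" for f
    by (cases f) (auto simp: defs bij in_face_vertices_iff)
  have wface: "w \<in> face_vertices f" "white w" if "w \<in> white_vertices f" for f w
    using that by (auto simp: white_vertices_def)

  \<comment> \<open>The height of the lift of \<open>v b\<close> computed from the white vertex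
    \<open>w\<close> in the face \<open>f\<close>, with the sign of the face reversed.\<close>
  define G where "G f w = Z w - face_sign f * (tangential (m1 f) (m2 f) (fst (v b)) - tangential (m1 f) (m2 f) (fst (v w)))" for f w
  have Gf: "G f w = G f w'" if "w \<in> white_vertices f" "w' \<in> white_vertices f" "w \<noteq> w'" for f w w'
  proof -
    have "face_sign f * (tangential (m1 f) (m2 f) (fst (u w')) - tangential (m1 f) (m2 f) (fst (u w))) =
        face_sign f * (tangential (n1 f) (n2 f) (fst (u w)) - tangential (n1 f) (n2 f) (fst (u w')))"
      using opp[OF that] by simp
    then show ?thesis
      using Z[OF wface(1)[OF that(1)]] Z[OF wface(1)[OF that(2)]]
        vw[OF wface(2)[OF that(1)]] vw[OF wface(2)[OF that(2)]] by (simp add: G_def algebra_simps)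
  qed
  have Ge: "G f w = G f' w" if "adjacent w b" "{f. {w, b} \<subseteq> face_vertices f} = {f, f'}" "f \<noteq> f'" for f f' w
    using edge[OF that] by (simp add: G_def algebra_simps)
  \<comment> \<open>Going around the four faces at \<open>b\<close> shows that all these computed
    heights agree.\<close>
  define zt where "zt = G F1 e1"
  have "G F1 e2 = zt" unfolding zt_def using wv(1) neq by (intro Gf) auto
  moreover have "G F1 e2 = G F2 e2"
    by (rule Ge) (use faces_at_edge(2)[of i j] in \<open>simp_all add: defs bij adjacent_def insert_commute\<close>)
  moreover have "G F2 e2 = G F2 e3" using wv(2) neq by (intro Gf) auto
  moreover have "G F2 e3 = G F3 e3"
    by (rule Ge) (use faces_at_edge(1)[of "i - 1" j] in \<open>simp_all add: defs bij adjacent_def\<close>)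
  moreover have "G F3 e3 = G F3 e4" using wv(3) neq by (intro Gf) auto
  moreover have "G F4 e4 = G F3 e4"
    by (rule Ge) (use faces_at_edge(2)[of i "j - 1"] in \<open>simp_all add: defs bij adjacent_def\<close>)
  moreover have "G F4 e4 = G F4 e1" using wv(4) neq by (intro Gf) auto
  ultimately have zt: "G f w = zt" if "b \<in> face_vertices f" "w \<in> white_vertices f" for f w
    using that bF[of f] wv zt_def by auto

  define bx vx by' vy where "bx = fst (u b)$1" and "vx = fst (v b)$1" and "by' = fst (u b)$2" and "vy = fst (v b)$2"
  define X Y R where "X w = fst (u w)$1" and "Y w = fst (u w)$2" and "R w = snd (u w)" for w
  note coord = bx_def vx_def by'_def vy_def X_def Y_def R_def
  have ub: "n1 f * (bx - X w) + n2 f * (by' - Y w) = R w"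
      "Z b - Z w = face_sign f * (n1 f * (by' - Y w) - n2 f * (bx - X w))"
    and vb: "m1 f * (vx - X w) + m2 f * (vy - Y w) = R w"
      "zt - Z w = - (face_sign f * (m1 f * (vy - Y w) - m2 f * (vx - X w)))"
    if "b \<in> face_vertices f" "w \<in> white_vertices f" for f w
    using cu[OF that(1)] cu[OF wface(1)[OF that(2)]] cv[OF that(1)] cv[OF wface(1)[OF that(2)]] r(2,3)
      Z[OF that(1)] Z[OF wface(1)[OF that(2)]] zt[OF that] vw[OF wface(2)[OF that(2)]]
    by (simp_all add: coord G_def tangential_def algebra_simps)

  have ss: "(face_sign f * x)\<^sup>2 = x\<^sup>2" for f x by (simp add: power_mult_distrib face_sign_squared)
  \<comment> \<open>Both lifts lie on each adjacent white sphere.\<close>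
  have ub_sphere: "(bx - X w)\<^sup>2 + (by' - Y w)\<^sup>2 - (Z b - Z w)\<^sup>2 = (R w)\<^sup>2"
    and vb_sphere: "(vx - X w)\<^sup>2 + (vy - Y w)\<^sup>2 - (zt - Z w)\<^sup>2 = (R w)\<^sup>2"
    if "b \<in> face_vertices f" "w \<in> white_vertices f" for f w
    using unit_decomposition[OF n[of f], of "bx - X w" "by' - Y w"] unit_decomposition[OF m[of f], of "vx - X w" "vy - Y w"]
    unfolding ub[OF that] vb[OF that] ss power2_minus by simp_all

  show ?thesis
  proof (cases "(bx - vx)\<^sup>2 + (by' - vy)\<^sup>2 < (Z b - zt)\<^sup>2")
    case True
    \<comment> \<open>Subtracting the two sphere equations leaves a linear equation for the white
      center, in which \<open>2 * e\<close> is the coefficient of its height; \<open>d\<close>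
      collects the constants.\<close>
    define e where "e = Z b - zt"
    have e: "e \<noteq> 0" "e\<^sup>2 > 0" using True by (auto simp: e_def) (smt (verit) sum_power2_ge_zero)+
    define d where "d = (zt\<^sup>2 - (Z b)\<^sup>2 + bx\<^sup>2 + by'\<^sup>2 - vx\<^sup>2 - vy\<^sup>2) / (2 * e)"
    show ?thesis
    proof (rule that[of "(bx - vx) / e" "(by' - vy) / e" "- d"])
      show "((bx - vx) / e)\<^sup>2 + ((by' - vy) / e)\<^sup>2 < 1"
        using True e by (simp add: power_divide e_def flip: add_divide_distrib)
      fix w assume "adjacent b w"
      then obtain f where "b \<in> face_vertices f" "w \<in> white_vertices f" using neighbour_in_face b by blast
      from ub_sphere[OF this] vb_sphere[OF this]
      have "2 * e * Z w = 2 * ((bx - vx) * X w + (by' - vy) * Y w) - (zt\<^sup>2 - (Z b)\<^sup>2 + bx\<^sup>2 + by'\<^sup>2 - vx\<^sup>2 - vy\<^sup>2)"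
        unfolding e_def by algebra
      then have "Z w = (2 * ((bx - vx) * X w + (by' - vy) * Y w) - (zt\<^sup>2 - (Z b)\<^sup>2 + bx\<^sup>2 + by'\<^sup>2 - vx\<^sup>2 - vy\<^sup>2)) / (2 * e)"
        using e(1) by (simp add: eq_divide_eq mult.commute)
      also have "\<dots> = (bx - vx) / e * X w + (by' - vy) / e * Y w - d"
        using e(1) by (simp add: d_def diff_divide_distrib add_divide_distrib left_diff_distrib)
      finally show "Z w = (bx - vx) / e * fst (u w)$1 + (by' - vy) / e * fst (u w)$2 + - d"
        by (simp add: X_def Y_def)
    qed
  next
    case False
    define C where "C w w' x y = (X w' - X w) * (y - Y w) - (Y w' - Y w) * (x - X w)" for w w' x y
    have mirror: "((bx - vx)\<^sup>2 + (by' - vy)\<^sup>2 - (Z b - zt)\<^sup>2) * ((X w' - X w)\<^sup>2 + (Y w' - Y w)\<^sup>2)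
        = - 4 * (C w w' bx by' * C w w' vx vy)"
      if f: "b \<in> face_vertices f" "w \<in> white_vertices f" "w' \<in> white_vertices f" "w \<noteq> w'" for f w w'
    proof -
      have a: "m1 f * (X w' - X w) + m2 f * (Y w' - Y w) = n1 f * (X w' - X w) + n2 f * (Y w' - Y w)"
        using ub(1)[OF f(1,2)] ub(1)[OF f(1,3)] vb(1)[OF f(1,2)] vb(1)[OF f(1,3)] by (simp add: algebra_simps)
      have b: "m1 f * (Y w' - Y w) - m2 f * (X w' - X w) = - (n1 f * (Y w' - Y w) - n2 f * (X w' - X w))"
        using opp[OF f(2-4)] by (simp add: coord tangential_def algebra_simps)
      have "Z b - zt = face_sign f * ((n1 f * (by' - Y w) - n2 f * (bx - X w)) + (m1 f * (vy - Y w) - m2 f * (vx - X w)))"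
        using ub(2)[OF f(1,2)] vb(2)[OF f(1,2)] by (simp add: algebra_simps)
      then have "(Z b - zt)\<^sup>2 = ((n1 f * (by' - Y w) - n2 f * (bx - X w)) + (m1 f * (vy - Y w) - m2 f * (vx - X w)))\<^sup>2"
        by (simp only: ss)
      then show ?thesis
        using lorentz_mirror[OF n m a b ub(1)[OF f(1,2)] vb(1)[OF f(1,2)]] by (simp add: C_def)
    qed
    have F1: "b \<in> face_vertices F1" "e1 \<in> white_vertices F1" "e2 \<in> white_vertices F1"
      using bF wv by auto
    \<comment> \<open>For different points the side condition makes the right-hand side of
      \<open>mirror\<close> negative, although a difference that is not timelike makes the left-hand
      side nonnegative.\<close>
    have same: "fst (u b) = fst (v b)"
    proof (rule ccontr)
      assume "fst (u b) \<noteq> fst (v b)"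
      then have "C e1 e2 bx by' * C e1 e2 vx vy > 0"
        using side[OF b F1 neq(1)] by (simp add: C_def coord)
      moreover have "((bx - vx)\<^sup>2 + (by' - vy)\<^sup>2 - (Z b - zt)\<^sup>2) * ((X e2 - X e1)\<^sup>2 + (Y e2 - Y e1)\<^sup>2) \<ge> 0"
        using False by (intro mult_nonneg_nonneg) auto
      ultimately show False using mirror[OF F1 neq(1)] by linarith
    qed
    then have vxy: "vx = bx" "vy = by'" by (auto simp: coord)
    then have "(Z b - zt)\<^sup>2 = 0" using False by (simp add: not_less)
    then have collinear: "C w w' bx by' = 0"
      if "b \<in> face_vertices f" "w \<in> white_vertices f" "w' \<in> white_vertices f" "w \<noteq> w'" for f w w'
      using mirror[OF that] vxy by simp
    \<comment> \<open>The lifted black point equals its mirror image and all four white centers lie on one line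
      through it.\<close>
    define S where "S w w' \<longleftrightarrow> (\<exists>l. X w' - bx = l * (X w - bx) \<and> Y w' - by' = l * (Y w - by') \<and> Z w' - Z b = l * (Z w - Z b))" for w w'
    have S_refl: "S w w" for w unfolding S_def by (intro exI[of _ 1]) simp
    have S_trans: "S w w''" if "S w w'" "S w' w''" for w w' w''
      using that unfolding S_def by (metis mult.assoc)
    \<comment> \<open>Nonzero white radii keep the black point away from the white centers.\<close>
    have nz: "bx - X w \<noteq> 0 \<or> by' - Y w \<noteq> 0" if "b \<in> face_vertices f" "w \<in> white_vertices f" for f w
      using ub(1)[OF that] r(1)[OF wface(2)[OF that(2)]] by (auto simp: R_def)
    have S_face: "S w w'" if f: "b \<in> face_vertices f" "w \<in> white_vertices f" "w' \<in> white_vertices f" "w \<noteq> w'" for f w w'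
    proof -
      define x y x' y' where "x = X w - bx" and "y = Y w - by'" and "x' = X w' - bx" and "y' = Y w' - by'"
      have D: "x\<^sup>2 + y\<^sup>2 \<noteq> 0" using nz[OF f(1,2)] by (auto simp: x_def y_def sum_power2_eq_zero_iff)
      define l where "l = (x' * x + y' * y) / (x\<^sup>2 + y\<^sup>2)"
      have l: "l * (x\<^sup>2 + y\<^sup>2) = x' * x + y' * y" using D by (simp add: l_def)
      have c: "x' * y = y' * x" using collinear[OF f] by (simp add: C_def x_def y_def x'_def y'_def algebra_simps)
      have "(x' - l * x) * (x\<^sup>2 + y\<^sup>2) = 0" "(y' - l * y) * (x\<^sup>2 + y\<^sup>2) = 0" using l c by algebra+
      then have l': "x' = l * x" "y' = l * y" using D by auto
      have "Z w' - Z b = face_sign f * (n1 f * y' - n2 f * x')"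
        using ub(2)[OF f(1,3)] by (simp add: x'_def y'_def algebra_simps)
      also have "\<dots> = l * (face_sign f * (n1 f * y - n2 f * x))" unfolding l' by (simp add: algebra_simps)
      also have "face_sign f * (n1 f * y - n2 f * x) = Z w - Z b"
        using ub(2)[OF f(1,2)] by (simp add: x_def y_def algebra_simps)
      finally show ?thesis using l' unfolding S_def x_def y_def x'_def y'_def by blast
    qed
    have S12: "S e1 e2" by (rule S_face[of F1]) (use bF wv neq in auto)
    have S23: "S e2 e3" by (rule S_face[of F2]) (use bF wv neq in auto)
    have S34: "S e3 e4" by (rule S_face[of F3]) (use bF wv neq in auto)
    have S: "S e1 w" if "adjacent b w" for w
    proof -
      obtain f where "b \<in> face_vertices f" "w \<in> white_vertices f" using neighbour_in_face b \<open>adjacent b w\<close> by blast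
      then have "w = e1 \<or> w = e2 \<or> w = e3 \<or> w = e4" using bF[of f] wv by auto
      then show ?thesis using S_refl S12 S23 S34 S_trans by blast
    qed
    \<comment> \<open>The vector from the lifted black point to one white center is spacelike, its
      Lorentz square being the squared radius. The plane through the line in this direction is
      chosen with gradient parallel to \<open>(x, y)\<close>, hence of squared length
      \<open>z\<^sup>2 / D\<close>.\<close>
    define x y z D where "x = X e1 - bx" and "y = Y e1 - by'" and "z = Z e1 - Z b" and "D = x\<^sup>2 + y\<^sup>2"
    have "D = z\<^sup>2 + (R e1)\<^sup>2"
      using ub_sphere[OF F1(1,2)] by (simp add: D_def x_def y_def z_def power2_commute)
    moreover have "(R e1)\<^sup>2 > 0" using r(1)[OF wface(2)[OF F1(2)]] by (simp add: R_def)
    ultimately have D: "z\<^sup>2 < D" "D > 0" by (simp_all add: add_nonneg_pos)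
    show ?thesis
    proof (rule that[of "z * x / D" "z * y / D" "Z b - z * x / D * bx - z * y / D * by'"])
      have "(z * x / D)\<^sup>2 + (z * y / D)\<^sup>2 = z\<^sup>2 * D / D\<^sup>2"
        by (simp add: power_divide power_mult_distrib distrib_left D_def flip: add_divide_distrib)
      also have "\<dots> = z\<^sup>2 / D" using D by (simp add: power2_eq_square)
      also have "\<dots> < 1" using D by simp
      finally show "(z * x / D)\<^sup>2 + (z * y / D)\<^sup>2 < 1" .
      fix w assume "adjacent b w"
      then obtain l where l: "X w - bx = l * x" "Y w - by' = l * y" "Z w - Z b = l * z"
        using S unfolding S_def x_def y_def z_def by blast
      have "z * x / D * (X w - bx) + z * y / D * (Y w - by') = l * z * (x\<^sup>2 + y\<^sup>2) / D"
        unfolding l by (simp add: power2_eq_square add_divide_distrib distrib_left mult_ac)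
      also have "\<dots> = Z w - Z b" using D l by (simp flip: D_def)
      finally show "Z w = z * x / D * fst (u w)$1 + z * y / D * fst (u w)$2 + (Z b - z * x / D * bx - z * y / D * by')"
        by (simp add: X_def Y_def algebra_simps)
    qed
  qed
qed

text \<open>Heights integrated from the edge tangents lift the circles and lines; the planes at
  black vertices come from comparing with an incircular image under Miquel dynamics.\<close>

lemma isothermic_pattern_lifts:
  assumes iso: "isothermic_pattern (u, uF)" and gen: "generic_pattern (u, uF)"
  shows "\<exists>C. isothermic_congruence C \<and> projected_pattern C = (u, uF)"
proof -
  obtain v vF where miq: "miquel (u, uF) (v, vF)" and inc: "incircular_pattern (u, uF)" "incircular_pattern (v, vF)"
    using iso unfolding isothermic_pattern_def by (metis surj_pair)
  have cyc: "cycle_pattern (u, uF)" "cycle_pattern (v, vF)" using inc by simp_all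
  obtain n1 n2 h where n: "\<And>f. (n1 f)\<^sup>2 + (n2 f)\<^sup>2 = 1" and uF: "\<And>f. uF f = normal_oline (n1 f) (n2 f) (h f)"
    and cu: "\<And>f z. z \<in> face_vertices f \<Longrightarrow> n1 f * fst (u z)$1 + n2 f * fst (u z)$2 + snd (u z) = h f"
    using pattern_normalsE[OF cyc(1)] by metis
  obtain m1 m2 g where m: "\<And>f. (m1 f)\<^sup>2 + (m2 f)\<^sup>2 = 1" and vF: "\<And>f. vF f = normal_oline (m1 f) (m2 f) (g f)"
    and cv: "\<And>f z. z \<in> face_vertices f \<Longrightarrow> m1 f * fst (v z)$1 + m2 f * fst (v z)$2 + snd (v z) = g f"
    using pattern_normalsE[OF cyc(2)] by metis
  have uE: "fst (u z) \<in> E2" and vE: "fst (v z) \<in> E2" for z using cyc by simp_all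
  have r: "snd (u w) \<noteq> 0" if "white w" for w using gen that by (simp add: generic_pattern_def)
  have r0: "snd (u b) = 0" "snd (v b) = 0" if "black b" for b using inc that by simp_all
  \<comment> \<open>Genericity speaks of every incircular image, hence of the one chosen
    above.\<close>
  have et: "edge_tangents (u, uF)" "edge_tangents (v, vF)" and ss: "same_side (u, uF) (v, vF)"
    using gen miq inc(2) unfolding generic_pattern_def by blast+
  have vw: "v w = u w" if "white w" for w using miq that by simp
  have uF': "uF = (\<lambda>f. normal_oline (n1 f) (n2 f) (h f))" and vF': "vF = (\<lambda>f. normal_oline (m1 f) (m2 f) (g f))"
    using uF vF by blast+
  \<comment> \<open>\<open>Z\<close> becomes the height of the center, \<open>k f\<close> the offset
    of the isotropic plane over the line of \<open>f\<close>.\<close>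
  obtain Z k where Z: "\<And>f z. z \<in> face_vertices f \<Longrightarrow> Z z = face_sign f * tangential (n1 f) (n2 f) (fst (u z)) + k f"
    using face_potential[of "\<lambda>f z. face_sign f * tangential (n1 f) (n2 f) (fst (u z))"]
      edge_tangents_lift[OF uE n et(1)[unfolded uF']] by metis
  have ct: "common_tangents (u w) (u w') = {normal_oline (n1 f) (n2 f) (h f), normal_oline (m1 f) (m2 f) (g f)}"
    if "w \<in> white_vertices f" "w' \<in> white_vertices f" "w \<noteq> w'" for f w w'
    using miq that by (simp add: uF vF)
  have opp: "tangential (m1 f) (m2 f) (fst (u w')) - tangential (m1 f) (m2 f) (fst (u w)) =
      - (tangential (n1 f) (n2 f) (fst (u w')) - tangential (n1 f) (n2 f) (fst (u w)))"
    if "w \<in> white_vertices f" "w' \<in> white_vertices f" "w \<noteq> w'" for f w w'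
    using common_tangents_opposite[OF n m uE uE, of w "snd (u w)" w' "snd (u w')"] ct[OF that] by simp
  \<comment> \<open>Distinct centers ensure that the affine hull in \<open>same_side\<close> is a
    line, as \<open>same_side_cross\<close> demands.\<close>
  have neq: "fst (u w) \<noteq> fst (u w')" if "w \<in> white_vertices f" "w' \<in> white_vertices f" "w \<noteq> w'" for f w w'
    using common_tangents_centers_neq[OF n m uE uE, of w "snd (u w)" w' "snd (u w')"] ct[OF that] by simp
  have side: "fst (u b) = fst (v b) \<or>
      ((fst (u w')$1 - fst (u w)$1) * (fst (u b)$2 - fst (u w)$2) - (fst (u w')$2 - fst (u w)$2) * (fst (u b)$1 - fst (u w)$1)) *
      ((fst (u w')$1 - fst (u w)$1) * (fst (v b)$2 - fst (u w)$2) - (fst (u w')$2 - fst (u w)$2) * (fst (v b)$1 - fst (u w)$1)) > 0"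
    if "black b" "b \<in> face_vertices f" "w \<in> white_vertices f" "w' \<in> white_vertices f" "w \<noteq> w'" for f b w w'
    using ss that same_side_cross[OF uE uE uE vE neq[OF that(3-5)], of b b] unfolding same_side.simps by blast
  note edge_v = edge_tangents_lift[OF vE m et(2)[unfolded vF']]
  define c where "c z = (vector [fst (u z)$1, fst (u z)$2, Z z] :: real^3, snd (u z))" for z
  define cF where "cF f = lifted_oline (n1 f) (n2 f) (face_sign f) (h f) (k f)" for f
  have "contact_congruence (c, cF)"
    unfolding contact_congruence.simps
  proof (intro conjI allI ballI)
    fix f
    show "isotropic_oline (cF f)" unfolding cF_def isotropic_oline_iff using n face_sign_squared by blast
    fix z assume "z \<in> face_vertices f"
    then show "lsphere_contact (c z) (cF f)"
      unfolding c_def cF_def lsphere_contact_lifted_oline[OF n face_sign_squared]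
      using cu Z by (simp add: vector_3 tangential_def)
  qed
  then have null: "null_congruence (c, cF)" using r r0 by (simp add: c_def)
  have "\<exists>P. spacelike_plane P \<and> (\<forall>w. adjacent b w \<longrightarrow> fst (c w) \<in> P)" if b: "black b" for b
  proof (rule lift_spacelike[where u = u and v = v and Z = Z and ?n1.0 = n1 and ?n2.0 = n2 and h = h
        and ?m1.0 = m1 and ?m2.0 = m2 and g = g and k = k and b = b])
    fix p q d assume "p\<^sup>2 + q\<^sup>2 < 1" "\<And>w. adjacent b w \<Longrightarrow> Z w = p * fst (u w)$1 + q * fst (u w)$2 + d"
    then show ?thesis
      by (intro exI[of _ "{x. x$3 = p * x$1 + q * x$2 + d}"] conjI spacelike_plane_graph) (auto simp: c_def vector_3)
  qed (fact n m cu cv Z vw opp edge_v side r r0[OF b] b)+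
  then have "isothermic_congruence (c, cF)" using null by simp
  moreover have "projected_pattern (c, cF) = (u, uF)"
  proof -
    have "(proj (fst (c z)), snd (c z)) = u z" for z
      using uE[of z] by (simp add: c_def proj_def prod_eq_iff E2_def vec3_simps)
    then show ?thesis by (simp add: cF_def projected_lifted_oline[OF n] uF')
  qed
  ultimately show ?thesis by blast
qed

theorem corollary9p3:
  shows "(\<forall>U. isothermic_pattern U \<and> generic_pattern U \<longrightarrow>
            (\<exists>C. isothermic_congruence C \<and> projected_pattern C = U)) \<and>
         (\<forall>C. isothermic_congruence C \<and> generic_congruence C \<longrightarrow>
            isothermic_pattern (projected_pattern C))"
  using isothermic_pattern_lifts isothermic_congruence_projects by (metis surj_pair)

end
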